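(* For every integer $n\ge 2$, $s(n)=s_0(n)$, where \[ s_0(n) = \begin{cases} 3\cdot 3^{\lfloor n/3\rfloor -1} & n\equiv 0 \pmod 3,\\ 4\cdot 3^{\lfloor n/3\rfloor -1} & n\equiv 1 \pmod 3,\\ 6\cdot 3^{\lfloor n/3\rfloor -1} & n\equiv 2 \pmod 3.\end{cases}\] In particular, every extremal program in $\mathcal{LP}_n$ has exactly $s_0(n)$ stable models. Moreover, the extremal programs in $\mathcal{LP}_n$ (the programs $P\in\mathcal{LP}_n$ with $s(P)=s(n)$) are exactly the programs in $\mathcal{E}_n$.
   Context: A (normal, propositional) logic program is a finite set of clauses of the form $a\leftarrow b_1,\ldots,b_m,\mathbf{not}(c_1),\ldots,\mathbf{not}(c_k)$ ($m,k\ge 0$), where $a,b_i,c_j$ are atoms; $a$ is the head and the other literals form the body. For a set of atoms $M$, the Gelfond–Lifschitz reduct $P^M$ is obtained from $P$ by deleting every clause whose body contains some $\mathbf{not}(c)$ with $c\in M$, and deleting all negative literals from the remaining clauses. $M$ is a stable model of $P$ if $M$ is the least model of the Horn program $P^M$. Let $s(P)$ be the number of stable models of $P$. $\mathcal{LP}_n$ is the class of logic programs with at most $n$ clauses, and $s(n)=\max\{s(P): P\in\mathcal{LP}_n\}$. For a set of atoms $A=\{a_1,\ldots,a_k\}$, the canonical program $CP[A]$ consists of the $k$ clauses $a_i\leftarrow \mathbf{not}(a_1),\ldots,\mathbf{not}(a_{i-1}),\mathbf{not}(a_{i+1}),\ldots,\mathbf{not}(a_k)$, $i=1,\ldots,k$.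 A $2,3,4$-program is a program $P$ whose set of atoms can be partitioned into pairwise disjoint sets $A_1,\ldots,A_l$ with $2\le |A_i|\le 4$ such that $P=\bigcup_{i=1}^l CP[A_i]$; its signature is $\langle\lambda_2,\lambda_3,\lambda_4\rangle$, where $\lambda_j$ is the number of $A_i$ with $|A_i|=j$. Up to renaming atoms, a $2,3,4$-program is determined by its signature. For $k\ge1$ let $A(k)$, $C(k)$, $C'(k)$ be the $2,3,4$-programs with signatures $\langle 0,k,0\rangle$, $\langle 2,k-1,0\rangle$, $\langle 0,k-1,1\rangle$ respectively, and for $k\ge 0$ let $B(k)$ be the one with signature $\langle 1,k,0\rangle$. An atom occurring in $P$ is redundant if it is not the head of any clause of $P$. $\overline{P}$ denotes the program obtained from $P$ by removing all negated occurrences $\mathbf{not}(q)$ of redundant atoms $q$. $\mathcal{E}_n$ is the class of programs $P$ such that $\overline{P}$ is (up to renaming atoms) $A(k)$ if $n=3k$ ($k\ge1$), $B(k)$ if $n=3k+2$ ($k\ge 0$), and $C(k)$ or $C'(k)$ if $n=3k+1$ ($k\ge1$).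
   Formalization: The extremal programs are shown to be exactly the programs of E_n having at most n clauses; as defined, E_n also contains programs with more than n clauses (e.g. a←not b; a←not b, not q; b←not a lies in E_2 but not LP_2). *)

theory Defs
  imports Complex_Main "HOL-Library.Disjoint_Sets" "HOL-Library.Infinite_Typeclass"
begin

datatype 'a clause = Clause (head: 'a) (pos: "'a set") (neg: "'a set")

type_synonym 'a program = "'a clause set"

definition logic_program :: "'a program \<Rightarrow> bool" where
  "logic_program P \<longleftrightarrow> finite P \<and> (\<forall>c\<in>P. finite (pos c) \<and> finite (neg c))"

definition heads :: "'a program \<Rightarrow> 'a set" where
  "heads P = head ` P"

definition atoms :: "'a program \<Rightarrow> 'a set" where
  "atoms P = (\<Union>c\<in>P. {head c} \<union> pos c \<union> neg c)"

definition satisfies :: "'a set \<Rightarrow> 'a clause \<Rightarrow> bool" where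
  "satisfies M c \<longleftrightarrow> (pos c \<subseteq> M \<and> neg c \<inter> M = {} \<longrightarrow> head c \<in> M)"

definition is_model :: "'a set \<Rightarrow> 'a program \<Rightarrow> bool" where
  "is_model M P \<longleftrightarrow> (\<forall>c\<in>P. satisfies M c)"

definition is_least_model :: "'a set \<Rightarrow> 'a program \<Rightarrow> bool" where
  "is_least_model M P \<longleftrightarrow> is_model M P \<and> (\<forall>N. is_model N P \<longrightarrow> M \<subseteq> N)"

definition reduct :: "'a program \<Rightarrow> 'a set \<Rightarrow> 'a program" where
  "reduct P M = {Clause (head c) (pos c) {} | c. c \<in> P \<and> neg c \<inter> M = {}}"

definition stable_model :: "'a program \<Rightarrow> 'a set \<Rightarrow> bool" where
  "stable_model P M \<longleftrightarrow> is_least_model M (reduct P M)"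

definition num_stable :: "'a program \<Rightarrow> nat" where
  "num_stable P = card {M. stable_model P M}"

definition LP :: "nat \<Rightarrow> 'a program set" where
  "LP n = {P. logic_program P \<and> card P \<le> n}"

text \<open>The type argument names the universe of atoms. The maximum is over a finite nonempty
  set of values; see \<open>finite_num_stable_LP\<close> and \<open>LP_nonempty\<close> below.\<close>

definition max_stable :: "'a itself \<Rightarrow> nat \<Rightarrow> nat" where
  "max_stable _ n = Max (num_stable ` (LP n :: 'a program set))"

definition extremal :: "nat \<Rightarrow> 'a program set" where
  "extremal n = {P \<in> LP n. num_stable P = max_stable TYPE('a) n}"

text \<open>An integer exponent is needed: for \<open>n = 2\<close> it is \<open>-1\<close>.\<close>

definition s0 :: "nat \<Rightarrow> real" where
  "s0 n = (if n mod 3 = 0 then 3 * 3 powi (int (n div 3) - 1)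
           else if n mod 3 = 1 then 4 * 3 powi (int (n div 3) - 1)
           else 6 * 3 powi (int (n div 3) - 1))"

definition CP :: "'a set \<Rightarrow> 'a program" where
  "CP A = (\<lambda>a. Clause a {} (A - {a})) ` A"

definition program_234 :: "'a program \<Rightarrow> nat \<times> nat \<times> nat \<Rightarrow> bool" where
  "program_234 P sig \<longleftrightarrow>
     (\<exists>\<A>. finite \<A> \<and> partition_on (atoms P) \<A> \<and> (\<forall>A\<in>\<A>. 2 \<le> card A \<and> card A \<le> 4) \<and>
          P = (\<Union>A\<in>\<A>. CP A) \<and>
          sig = (card {A\<in>\<A>. card A = 2}, card {A\<in>\<A>. card A = 3}, card {A\<in>\<A>. card A = 4}))"

text \<open>A signature determines a program up to renaming of atoms, so the following predicates
  say that \<open>P\<close> is a renamed copy of the respective program.\<close>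

definition is_A :: "nat \<Rightarrow> 'a program \<Rightarrow> bool" where
  "is_A k P \<longleftrightarrow> program_234 P (0, k, 0)"

definition is_B :: "nat \<Rightarrow> 'a program \<Rightarrow> bool" where
  "is_B k P \<longleftrightarrow> program_234 P (1, k, 0)"

definition is_C :: "nat \<Rightarrow> 'a program \<Rightarrow> bool" where
  "is_C k P \<longleftrightarrow> program_234 P (2, k - 1, 0)"

definition is_C' :: "nat \<Rightarrow> 'a program \<Rightarrow> bool" where
  "is_C' k P \<longleftrightarrow> program_234 P (0, k - 1, 1)"

definition redundant :: "'a program \<Rightarrow> 'a \<Rightarrow> bool" where
  "redundant P q \<longleftrightarrow> q \<in> atoms P \<and> q \<notin> heads P"

definition overline :: "'a program \<Rightarrow> 'a program" where
  "overline P = (\<lambda>c. Clause (head c) (pos c) (neg c - {q. redundant P q})) ` P"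

text \<open>Two clauses of \<open>P\<close> that differ only in negated redundant atoms have the same image in
  \<open>overline P\<close>, so a member of \<open>EE n\<close> may have more than \<open>n\<close> clauses.\<close>

definition EE :: "nat \<Rightarrow> 'a program set" where
  "EE n = {P. logic_program P \<and>
     ((\<exists>k\<ge>1. n = 3 * k \<and> is_A k (overline P)) \<or>
      (\<exists>k. n = 3 * k + 2 \<and> is_B k (overline P)) \<or>
      (\<exists>k\<ge>1. n = 3 * k + 1 \<and> (is_C k (overline P) \<or> is_C' k (overline P))))}"

lemma stable_model_subset_heads:
  assumes "stable_model P M"
  shows "M \<subseteq> heads P"
proof -
  have "is_model M (reduct P M)" and least: "\<And>N. is_model N (reduct P M) \<Longrightarrow> M \<subseteq> N"
    using assms by (auto simp: stable_model_def is_least_model_def)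
  then have "is_model (M \<inter> heads P) (reduct P M)"
    by (auto simp: is_model_def satisfies_def reduct_def heads_def)
  then show ?thesis
    using least by blast
qed

lemma num_stable_le:
  assumes "P \<in> LP n"
  shows "num_stable P \<le> 2 ^ n"
proof -
  have fin: "finite P" and le: "card P \<le> n"
    using assms by (auto simp: LP_def logic_program_def)
  have "num_stable P \<le> card (Pow (heads P))"
    unfolding num_stable_def using fin stable_model_subset_heads
    by (intro card_mono) (auto simp: heads_def)
  also have "\<dots> = 2 ^ card (heads P)"
    using fin by (simp add: card_Pow heads_def)
  also have "\<dots> \<le> 2 ^ n"
    using card_image_le[OF fin, of head] le by (intro power_increasing) (auto simp: heads_def)
  finally show ?thesis .
qed

lemma finite_num_stable_LP: "finite (num_stable ` LP n)"
  by (rule finite_subset[of _ "{..2 ^ n}"]) (auto intro: num_stable_le)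

lemma LP_nonempty: "LP n \<noteq> {}"
proof -
  have "{} \<in> LP n"
    by (simp add: LP_def logic_program_def)
  then show ?thesis by blast
qed

end

theory Submission
  imports Defs "HOL-Library.FuncSet"
begin

text \<open>
  If every atom is the head of at most one clause, unfolding positive body atoms turns a program into
  a purely negative one, whose stable models are the kernels of a digraph on its heads. Kernels are
  counted as maximal independent sets are in the Moon-Moser theorem. A kernel containing \<open>q\<close> is \<open>q\<close>
  together with a kernel of the digraph without \<open>q\<close> and its in-neighbours. If some in-degree is at
  least 3, branch on whether that vertex is in the kernel. Otherwise some vertex \<open>q\<close> has out-degree at
  most 2, and every kernel meets \<open>q\<close> or an out-neighbour of \<open>q\<close>. Equality in this last count means that
  the branches are extremal and disjoint, which forces \<open>q\<close> and its out-neighbours to be an isolated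
  clique.

  If some atom \<open>q\<close> is the head of two clauses, deciding \<open>q\<close> removes both, so \<open>P\<close> is not extremal: two
  branches with \<open>n - 2\<close> and at most \<open>n - 3\<close> clauses are too few, and if \<open>q\<close> occurs in no other clause,
  then the two branches coincide because stable models form an antichain.
\<close>

section \<open>Moon-Moser numbers\<close>

text \<open>The largest number of maximal independent sets of a graph with \<open>n\<close>
  vertices. Tripling starts only at 5, since \<open>mm 4 = 4\<close> exceeds
  \<open>3 * mm 1\<close>.\<close>

fun mm :: "nat \<Rightarrow> nat" where
  "mm 0 = 1"
| "mm (Suc 0) = 1"
| "mm (Suc (Suc 0)) = 2"
| "mm (Suc (Suc (Suc 0))) = 3"
| "mm (Suc (Suc (Suc (Suc 0)))) = 4"
| "mm (Suc (Suc (Suc (Suc (Suc n))))) = 3 * mm (Suc (Suc n))"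

lemma mm_pos: "0 < mm n"
  by (induction n rule: mm.induct) auto

lemma mm_Suc_le: "mm n \<le> mm (Suc n)"
  by (induction n rule: mm.induct) auto

lemma mm_mono: "m \<le> n \<Longrightarrow> mm m \<le> mm n"
  using lift_Suc_mono_le[of mm, OF mm_Suc_le] .

lemma mm_Suc_less: "0 < n \<Longrightarrow> mm n < mm (Suc n)"
  by (induction n rule: mm.induct) auto

text \<open>The only plateau of \<open>mm\<close> lies between 0 and 1, so \<open>n = 1\<close> is
  the only upper argument to exclude. It returns as the exceptional size in the equality arguments
  below.\<close>

lemma mm_less:
  assumes "m < n" "n \<noteq> 1"
  shows "mm m < mm n"
proof -
  obtain k where k: "n = Suc k" using assms(1) by (cases n) auto
  then have "mm m \<le> mm k" using assms by (intro mm_mono) auto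
  also have "\<dots> < mm n" using k assms mm_Suc_less by auto
  finally show ?thesis .
qed

text \<open>The inequalities from here to \<open>mm_triple_eq\<close> compare each branching with
  the target value: a repeated head, a vertex of in-degree 3 or at least 4, and a closed
  out-neighbourhood of 2 or 3 vertices. The \<open>_eq\<close> lemmas restrict the sizes for which
  equality can occur.\<close>

lemma mm_two_three: "mm n + mm (n + 1) < mm (n + 3)"
  by (induction n rule: mm.induct) (auto simp: numeral_eq_Suc)

lemma mm_one_four: "mm n + mm (n + 3) \<le> mm (n + 4)"
  by (induction n rule: mm.induct) (auto simp: numeral_eq_Suc)

lemma mm_one_four_eq:
  assumes "mm n + mm (n + 3) = mm (n + 4)"
  shows "n mod 3 = 0"
proof -
  have "mm n + mm (Suc (Suc (Suc n))) = mm (Suc (Suc (Suc (Suc n)))) \<Longrightarrow> n mod 3 = 0"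
    by (induction n rule: mm.induct) (auto simp: mod_Suc)
  moreover have "n + 3 = Suc (Suc (Suc n))" "n + 4 = Suc (Suc (Suc (Suc n)))" by simp_all
  ultimately show ?thesis using assms by argo
qed

lemma mm_one_five: "mm n + mm (n + 4) < mm (n + 5)"
  by (induction n rule: mm.induct) (auto simp: numeral_eq_Suc)

lemma mm_double: "2 * mm n \<le> mm (n + 2)"
  by (induction n rule: mm.induct) (auto simp: numeral_eq_Suc)

lemma mm_double_eq:
  assumes "2 * mm n = mm (n + 2)"
  shows "n mod 3 \<noteq> 1"
proof -
  have "2 * mm n = mm (Suc (Suc n)) \<Longrightarrow> n mod 3 \<noteq> 1"
    by (induction n rule: mm.induct) (auto simp: mod_Suc)
  moreover have "n + 2 = Suc (Suc n)" by simp
  ultimately show ?thesis using assms by argo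
qed

lemma mm_triple: "3 * mm n \<le> mm (n + 3)"
  by (induction n rule: mm.induct) (auto simp: numeral_eq_Suc)

lemma mm_triple_eq: "3 * mm n = mm (n + 3) \<Longrightarrow> n \<noteq> 1"
  by (auto simp: numeral_eq_Suc)

lemma mm_values:
  "mm (3 * k) = 3 ^ k"
  "mm (3 * k + 2) = 2 * 3 ^ k"
  "mm (3 * k + 4) = 4 * 3 ^ k"
proof (induction k)
  case (Suc k)
  have *: "mm (n + 3) = 3 * mm n" if "n \<noteq> 1" for n
    using that by (induction n rule: mm.induct) (auto simp: numeral_eq_Suc)
  have "3 * k \<noteq> 1" by presburger
  then have "mm (3 * k + 3) = 3 ^ Suc k" "mm (3 * k + 2 + 3) = 2 * 3 ^ Suc k"
    "mm (3 * k + 4 + 3) = 4 * 3 ^ Suc k"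
    using Suc *[of "3 * k"] *[of "3 * k + 2"] *[of "3 * k + 4"] by simp_all
  then show "mm (3 * Suc k) = 3 ^ Suc k" "mm (3 * Suc k + 2) = 2 * 3 ^ Suc k"
    "mm (3 * Suc k + 4) = 4 * 3 ^ Suc k"
    by (simp_all add: algebra_simps)
qed (simp_all add: numeral_eq_Suc)

lemma s0_eq_mm:
  assumes "2 \<le> n"
  shows "s0 n = real (mm n)"
proof -
  have "n = 3 * (n div 3) \<or> n = 3 * (n div 3) + 2 \<or> (n = 3 * (n div 3 - 1) + 4 \<and> 1 \<le> n div 3)"
    using assms by presburger
  then consider k where "n = 3 * Suc k" | k where "n = 3 * k + 2" | k where "n = 3 * k + 4"
    by (metis Suc_pred' assms gr0I mult_zero_right not_numeral_le_zero)
  then show ?thesis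
  proof cases
    case (1 k)
    then have "real (mm n) = 3 * 3 ^ k" using mm_values(1)[of "Suc k"] by simp
    then show ?thesis using 1 by (simp add: s0_def power_int_def)
  next
    case (2 k)
    then have "real (mm n) = 2 * 3 ^ k" using mm_values(2)[of k] by simp
    moreover have "n div 3 = k" "n mod 3 = 2" using 2 by presburger+
    \<comment> \<open>For \<open>k = 0\<close> the exponent in \<open>s0\<close> is -1, and
      \<open>6 * 3 powi (-1)\<close> is 2.\<close>
    ultimately show ?thesis
      by (cases k) (auto simp: s0_def power_int_def)
  next
    case (3 k)
    then have "real (mm n) = 4 * 3 ^ k" using mm_values(3)[of k] by simp
    moreover have "n div 3 = Suc k" "n mod 3 = 1" using 3 by presburger+
    ultimately show ?thesis
      by (auto simp: s0_def power_int_def)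
  qed
qed

section \<open>Kernels of digraphs\<close>

text \<open>\<open>D q\<close> is the set of out-neighbours of \<open>q\<close> and may leave
  \<open>V\<close>. Passing to an induced subdigraph thus shrinks \<open>V\<close> and keeps
  \<open>D\<close>.\<close>

definition kernels :: "'a set \<Rightarrow> ('a \<Rightarrow> 'a set) \<Rightarrow> 'a set set" where
  "kernels V D = {M. M \<subseteq> V \<and> (\<forall>q\<in>V. q \<in> M \<longleftrightarrow> D q \<inter> M = {})}"

definition in_nbrs :: "'a set \<Rightarrow> ('a \<Rightarrow> 'a set) \<Rightarrow> 'a \<Rightarrow> 'a set" where
  "in_nbrs V D q = {u \<in> V. u \<noteq> q \<and> q \<in> D u}"

definition clique_union :: "'a set \<Rightarrow> ('a \<Rightarrow> 'a set) \<Rightarrow> 'a set set \<Rightarrow> bool" where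
  "clique_union V D \<A> \<longleftrightarrow> partition_on V \<A> \<and> (\<forall>A\<in>\<A>. \<forall>q\<in>A. D q \<inter> V = A - {q})"

text \<open>The number of blocks of size 3 is omitted: it is determined by the total size \<open>n\<close>.\<close>

definition mm_sizes :: "nat \<Rightarrow> 'a set set \<Rightarrow> bool" where
  "mm_sizes n \<A> \<longleftrightarrow> (\<forall>A\<in>\<A>. 2 \<le> card A \<and> card A \<le> 4) \<and>
     (card {A\<in>\<A>. card A = 2}, card {A\<in>\<A>. card A = 4}) \<in>
       (if n mod 3 = 0 then {(0, 0)} else if n mod 3 = 2 then {(1, 0)} else {(2, 0), (0, 1)})"

lemma finite_kernels: "finite V \<Longrightarrow> finite (kernels V D)"
  by (rule finite_subset[of _ "Pow V"]) (auto simp: kernels_def)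

lemma card_without_in_nbrs:
  assumes "finite V" "u \<in> V"
  shows "card (V - {u} - in_nbrs V D u) + Suc (card (in_nbrs V D u)) = card V"
proof -
  have "in_nbrs V D u \<subseteq> V - {u}" by (auto simp: in_nbrs_def)
  then have "card (V - {u} - in_nbrs V D u) + card (in_nbrs V D u) = card (V - {u})"
    using assms(1) by (metis card_Diff_subset card_mono finite_Diff finite_subset le_add_diff_inverse2)
  then show ?thesis using card.remove[OF assms] by simp
qed

section \<open>Branching on whether a vertex lies in the kernel\<close>

lemma kernels_avoid: "q \<in> V \<Longrightarrow> {M \<in> kernels V D. q \<notin> M} \<subseteq> kernels (V - {q}) D"
  by (auto simp: kernels_def)

lemma kernels_meet: "M \<in> kernels V D \<Longrightarrow> q \<in> V \<Longrightarrow> q \<in> M \<or> (\<exists>a\<in>D q \<inter> V. a \<in> M)"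
  by (auto simp: kernels_def)

lemma kernels_independent: "M \<in> kernels V D \<Longrightarrow> u \<in> M \<Longrightarrow> w \<in> D u \<Longrightarrow> w \<notin> M"
  by (auto simp: kernels_def)

text \<open>In-neighbours of \<open>q\<close> are excluded by \<open>q\<close> itself, and the
  vertices that remain have no arc to \<open>q\<close>, so removing \<open>q\<close> does not affect
  their condition. Only inclusion holds: a kernel of the remainder may contain an out-neighbour of
  \<open>q\<close>.\<close>

lemma kernels_contain:
  "(\<lambda>M. M - {q}) ` {M \<in> kernels V D. q \<in> M} \<subseteq> kernels (V - {q} - in_nbrs V D q) D"
  by (force simp: kernels_def in_nbrs_def)

lemma inj_on_remove: "inj_on (\<lambda>M. M - {q}) {M. P M \<and> q \<in> M}"
  by (auto simp: inj_on_def)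

lemma card_kernels_contain:
  assumes "finite V"
  shows "card {M \<in> kernels V D. q \<in> M} \<le> card (kernels (V - {q} - in_nbrs V D q) D)"
  using assms by (intro card_inj_on_le[OF inj_on_remove kernels_contain] finite_kernels) auto

text \<open>Removing \<open>q\<close> is an injective map on these kernels, so the assumed
  cardinality makes it onto the kernels of the remainder.\<close>

lemma kernels_contain_surj:
  assumes "finite V" "N \<in> kernels (V - {q} - in_nbrs V D q) D"
    "card (kernels (V - {q} - in_nbrs V D q) D) \<le> card {M \<in> kernels V D. q \<in> M}"
  shows "insert q N \<in> kernels V D"
proof -
  have "(\<lambda>M. M - {q}) ` {M \<in> kernels V D. q \<in> M} = kernels (V - {q} - in_nbrs V D q) D"
    using assms by (intro card_seteq kernels_contain finite_kernels) (auto simp: card_image inj_on_remove)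
  then obtain M where "M \<in> kernels V D" "q \<in> M" "N = M - {q}"
    using assms(2) by blast
  then show ?thesis by (simp add: insert_absorb)
qed

text \<open>If no kernel contained \<open>w\<close>, all kernels would be kernels of
  \<open>V - {w}\<close>, which are too few.\<close>

lemma vertex_in_kernel:
  assumes fin: "finite V" and bound: "\<And>U. U \<subset> V \<Longrightarrow> card (kernels U D) \<le> mm (card U)"
    and eq: "card (kernels V D) = mm (card V)" and w: "w \<in> V"
  shows "\<exists>N\<in>kernels V D. w \<in> N"
proof (rule ccontr)
  assume none: "\<not> ?thesis"
  then have sub: "kernels V D \<subseteq> kernels (V - {w}) D"
    using kernels_avoid[OF w, of D] by blast
  show False
  \<comment> \<open>As \<open>mm 0 = mm 1\<close>, a single vertex needs its own argument: a kernel
    avoiding it would be empty, but the empty set is no kernel of \<open>{w}\<close>.\<close>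
  proof (cases "card V = 1")
    case True
    then have V: "V = {w}" using w by (metis card_1_singletonE singletonD)
    then have "kernels V D = {}" using none by (auto simp: kernels_def)
    then show False using eq mm_pos[of "card V"] by simp
  next
    case False
    have "card (kernels V D) \<le> mm (card (V - {w}))"
      using bound[of "V - {w}"] card_mono[OF finite_kernels sub] fin w by force
    also have "\<dots> < mm (card V)"
      using fin w False by (intro mm_less psubset_card_mono) auto
    finally show False using eq by simp
  qed
qed

text \<open>A branch with maximal count forces an extremal remainder.
  \<open>vertex_in_kernel\<close> finds a kernel of it through \<open>w\<close>, and
  \<open>kernels_contain_surj\<close> adds \<open>q\<close>. The common kernel serves to contradict
  an arc from \<open>q\<close> to \<open>w\<close> or the disjointness of their branches.\<close>

lemma tight_vertex:
  assumes fin: "finite V" and bound: "\<And>U. U \<subset> V \<Longrightarrow> card (kernels U D) \<le> mm (card U)"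
    and q: "q \<in> V" and tight: "mm (card (V - {q} - in_nbrs V D q)) \<le> card {M \<in> kernels V D. q \<in> M}"
    and w: "w \<in> V" "w \<noteq> q" "w \<notin> in_nbrs V D q"
  shows "\<exists>M\<in>kernels V D. q \<in> M \<and> w \<in> M"
proof -
  let ?R = "V - {q} - in_nbrs V D q"
  have R: "card (kernels ?R D) \<le> mm (card ?R)" using bound[of ?R] q by blast
  have "\<exists>N\<in>kernels ?R D. w \<in> N"
  proof (rule vertex_in_kernel)
    show "card (kernels ?R D) = mm (card ?R)"
      using R tight card_kernels_contain[OF fin, of D q] by linarith
    show "card (kernels U D) \<le> mm (card U)" if "U \<subset> ?R" for U
      using bound that by blast
  qed (use fin w in auto)
  then obtain N where N: "N \<in> kernels ?R D" "w \<in> N" by blast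
  then have "insert q N \<in> kernels V D"
    using R tight by (intro kernels_contain_surj[OF fin N(1)]) linarith
  then show ?thesis using N by blast
qed

lemma sum_eq_bound:
  fixes f :: "'b \<Rightarrow> nat"
  assumes "finite C" "\<And>x. x \<in> C \<Longrightarrow> f x \<le> m" "card C * m \<le> sum f C" "u \<in> C"
  shows "f u = m"
proof (rule ccontr)
  assume "f u \<noteq> m"
  then have "sum f C < sum (\<lambda>_. m) C"
    using assms by (intro sum_strict_mono_ex1) (auto intro!: bexI[of _ u] simp: le_neq_implies_less)
  then show False using assms(3) by simp
qed

text \<open>Every kernel meets the closed out-neighbourhood \<open>C\<close>, and each
  \<open>u\<close> in \<open>C\<close> removes itself and at least \<open>card C - 1\<close>
  in-neighbours. Equality makes the branches maximal and disjoint, which determines all arcs at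
  \<open>C\<close>. A remainder of size 1 is excluded because \<open>mm 0 = mm 1\<close> would hide
  an extra in-neighbour.\<close>

lemma branch_clique:
  fixes V :: "'a set"
  assumes fin: "finite V" and bound: "\<And>U. U \<subset> V \<Longrightarrow> card (kernels U D) \<le> mm (card U)"
    and q: "q \<in> V" and C: "C = insert q (D q \<inter> V)" and noloop: "\<And>u. u \<in> V \<Longrightarrow> u \<notin> D u"
    and deg: "\<And>u. u \<in> C \<Longrightarrow> card C \<le> Suc (card (in_nbrs V D u))"
  shows "card (kernels V D) \<le> card C * mm (card V - card C)"
    and "card (kernels V D) = card C * mm (card V - card C) \<Longrightarrow> card V - card C \<noteq> 1 \<Longrightarrow>
      (\<forall>u\<in>C. D u \<inter> V = C - {u}) \<and> (\<forall>x\<in>V - C. D x \<inter> C = {}) \<and>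
      card (kernels (V - C) D) = mm (card (V - C))"
proof -
  define m where "m = mm (card V - card C)"
  define S where "S u = {M \<in> kernels V D. u \<in> M}" for u
  define R where "R u = V - {u} - in_nbrs V D u" for u
  have CV: "C \<subseteq> V" and finC: "finite C" using C q fin by auto
  have finS: "finite (S u)" for u using finite_kernels[OF fin] by (auto simp: S_def)
  have cardR: "card (R u) + Suc (card (in_nbrs V D u)) = card V" if "u \<in> V" for u
    unfolding R_def using card_without_in_nbrs[OF fin that] .
  have SR: "card (S u) \<le> mm (card (R u))" if "u \<in> C" for u
    using card_kernels_contain[OF fin, of D u] bound[of "R u"] that CV
    unfolding S_def R_def by fastforce
  have Rm: "mm (card (R u)) \<le> m" if "u \<in> C" for u
    using cardR[of u] deg[OF that] that CV unfolding m_def by (intro mm_mono) auto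
  have Sm: "card (S u) \<le> m" if "u \<in> C" for u
    using SR[OF that] Rm[OF that] by linarith
  have cover: "kernels V D = (\<Union>u\<in>C. S u)"
    using kernels_meet[OF _ q, of _ D] by (auto simp: S_def C)
  have Ksum: "card (kernels V D) \<le> (\<Sum>u\<in>C. card (S u))"
    unfolding cover by (rule card_UN_le[OF finC])
  also have "\<dots> \<le> card C * m"
    using sum_bounded_above[of C "\<lambda>u. card (S u)" m] Sm by simp
  finally show "card (kernels V D) \<le> card C * mm (card V - card C)" unfolding m_def .
  assume eq: "card (kernels V D) = card C * mm (card V - card C)" and n1: "card V - card C \<noteq> 1"
  have SeqM: "card (S u) = m" if "u \<in> C" for u
    using sum_eq_bound[of C "\<lambda>u. card (S u)" m u] finC Sm Ksum eq that unfolding m_def by simp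
  have tight: "mm (card (R u)) \<le> card (S u)" if "u \<in> C" for u
    using Rm SeqM that by simp
  \<comment> \<open>A kernel in two branches is counted twice, so the union of the branches would
    have fewer than \<open>card C * m\<close> elements.\<close>
  have disj: "S u \<inter> S w = {}" if "u \<in> C" "w \<in> C" "u \<noteq> w" for u w
  proof (rule ccontr)
    assume "S u \<inter> S w \<noteq> {}"
    then obtain M where M: "M \<in> S u" "M \<in> S w" by blast
    have "kernels V D = (\<Union>x\<in>C - {u}. S x) \<union> (S u - {M})"
      using M that unfolding cover by blast
    then have "card (kernels V D) \<le> card (\<Union>x\<in>C - {u}. S x) + card (S u - {M})"
      by (simp add: card_Un_le)
    also have "\<dots> \<le> (\<Sum>x\<in>C - {u}. card (S x)) + card (S u - {M})"
      using card_UN_le[of "C - {u}" S] finC by simp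
    also have "\<dots> < (\<Sum>x\<in>C - {u}. card (S x)) + card (S u)"
      using M finS[of u] by (intro add_strict_left_mono psubset_card_mono) auto
    also have "\<dots> = card C * m"
      using sum.remove[OF finC that(1), of "\<lambda>x. card (S x)"] SeqM by simp
    finally show False using eq unfolding m_def by simp
  qed
  \<comment> \<open>An extra in-neighbour would leave a smaller remainder, whose bound is strictly
    below \<open>m\<close> by \<open>n1\<close>.\<close>
  have degC: "Suc (card (in_nbrs V D u)) = card C" if "u \<in> C" for u
  proof -
    have "\<not> card (R u) < card V - card C"
      using mm_less[of "card (R u)" "card V - card C"] n1 SR[OF that] SeqM[OF that]
      unfolding m_def by auto
    then show ?thesis using cardR[of u] deg[OF that] that CV by force
  qed
  \<comment> \<open>Two vertices of \<open>C\<close> share no kernel, so by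
    \<open>tight_vertex\<close> each is an in-neighbour of the other; \<open>degC\<close> leaves
    room for no more.\<close>
  have inC: "in_nbrs V D u = C - {u}" if u: "u \<in> C" for u
  proof (rule sym, rule card_seteq)
    show "finite (in_nbrs V D u)" using fin by (auto simp: in_nbrs_def)
    show "card (in_nbrs V D u) \<le> card (C - {u})"
      using degC[OF u] u finC by simp
    show "C - {u} \<subseteq> in_nbrs V D u"
    proof
      fix w assume w: "w \<in> C - {u}"
      show "w \<in> in_nbrs V D u"
      proof (rule ccontr)
        assume "w \<notin> in_nbrs V D u"
        then obtain M where "M \<in> kernels V D" "u \<in> M" "w \<in> M"
          using tight_vertex[OF fin bound, of u w] tight[OF u] w CV u
          unfolding R_def S_def by blast
        then show False using disj[of u w] w u by (auto simp: S_def)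
      qed
    qed
  qed
  \<comment> \<open>An arc from \<open>u\<close> to a vertex outside \<open>C\<close> would join two
    members of a common kernel, again by \<open>tight_vertex\<close>.\<close>
  have DC: "D u \<inter> V = C - {u}" if u: "u \<in> C" for u
  proof
    show "D u \<inter> V \<subseteq> C - {u}"
    proof
      fix w assume w: "w \<in> D u \<inter> V"
      then have "w \<noteq> u" using noloop by blast
      show "w \<in> C - {u}"
      proof (rule ccontr)
        assume "w \<notin> C - {u}"
        then obtain M where M: "M \<in> kernels V D" "u \<in> M" "w \<in> M"
          using tight_vertex[OF fin bound, of u w] tight[OF u] w CV u \<open>w \<noteq> u\<close> inC[OF u]
          unfolding R_def S_def by blast
        then show False using kernels_independent[OF M(1,2)] M(3) w by blast
      qed
    qed
    show "C - {u} \<subseteq> D u \<inter> V"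
    proof
      fix w assume w: "w \<in> C - {u}"
      then have "u \<in> in_nbrs V D w" using inC u by blast
      then show "w \<in> D u \<inter> V" using w CV by (auto simp: in_nbrs_def)
    qed
  qed
  have out: "D x \<inter> C = {}" if "x \<in> V - C" for x
    using inC that by (fastforce simp: in_nbrs_def)
  have RV: "R q = V - C" using inC[of q] C unfolding R_def by auto
  have "q \<in> C" using C by simp
  have "card (V - C) = card V - card C" using CV finC by (simp add: card_Diff_subset)
  moreover have "card (S q) \<le> card (kernels (V - C) D)"
    using card_kernels_contain[OF fin, of D q] RV unfolding S_def R_def by simp
  moreover have "card (kernels (V - C) D) \<le> mm (card (V - C))"
    using bound[of "V - C"] CV \<open>q \<in> C\<close> by blast
  ultimately have "card (kernels (V - C) D) = mm (card (V - C))"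
    using SeqM[OF \<open>q \<in> C\<close>] unfolding m_def by simp
  then show "(\<forall>u\<in>C. D u \<inter> V = C - {u}) \<and> (\<forall>x\<in>V - C. D x \<inter> C = {}) \<and>
      card (kernels (V - C) D) = mm (card (V - C))"
    using DC out by blast
qed

section \<open>Assembling clique unions block by block\<close>

lemma clique_union_insert:
  assumes "clique_union (V - C) D \<A>" "C \<subseteq> V" "C \<noteq> {}"
    "\<forall>u\<in>C. D u \<inter> V = C - {u}" "\<forall>x\<in>V - C. D x \<inter> C = {}"
  shows "clique_union V D (insert C \<A>)" "C \<notin> \<A>"
proof -
  have part: "partition_on (V - C) \<A>" and D: "\<And>A u. A \<in> \<A> \<Longrightarrow> u \<in> A \<Longrightarrow> D u \<inter> (V - C) = A - {u}"
    using assms(1) by (auto simp: clique_union_def)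
  have U: "\<Union>\<A> = V - C" using partition_onD1[OF part] by simp
  show "C \<notin> \<A>" using U assms(3) by blast
  have "partition_on V (insert C \<A>)"
    using part assms(2,3) U by (auto simp: partition_on_def disjoint_def disjnt_def)
  moreover have "D u \<inter> V = A - {u}" if "A \<in> \<A>" "u \<in> A" for A u
  proof -
    have "u \<in> V - C" using U that by blast
    then show ?thesis using D[OF that] assms(5) by blast
  qed
  ultimately show "clique_union V D (insert C \<A>)"
    using assms(4) by (auto simp: clique_union_def)
qed

lemma clique_union_finite: "clique_union V D \<A> \<Longrightarrow> finite V \<Longrightarrow> finite \<A>"
  by (metis clique_union_def finite_elements)

lemma card_filter_insert:
  assumes "finite \<A>" "C \<notin> \<A>"
  shows "card {A \<in> insert C \<A>. card A = k} = of_bool (card C = k) + card {A \<in> \<A>. card A = k}"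
proof -
  have "{A \<in> insert C \<A>. card A = k} = (if card C = k then {C} else {}) \<union> {A \<in> \<A>. card A = k}"
    by auto
  then show ?thesis using assms by auto
qed

text \<open>The conditions on \<open>k\<close> here and in \<open>mm_sizes_insert_2\<close> keep the
  block sizes admissible; they are supplied by \<open>mm_one_four_eq\<close> and
  \<open>mm_double_eq\<close>. A block of size 3 changes neither the residue nor the recorded
  counts.\<close>

lemma mm_sizes_insert_4:
  assumes "finite \<A>" "C \<notin> \<A>" "card C = 4" "\<And>A. A \<in> \<A> \<Longrightarrow> card A = 3" "k mod 3 = 0"
  shows "mm_sizes (k + 4) (insert C \<A>)"
proof -
  have "{A \<in> \<A>. card A = 2} = {}" "{A \<in> \<A>. card A = 4} = {}"
    using assms(4) by auto
  then have "card {A \<in> \<A>. card A = 2} = 0" "card {A \<in> \<A>. card A = 4} = 0"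
    by (simp_all only: card.empty)
  moreover have "(k + 4) mod 3 = 1" using assms(5) by presburger
  ultimately show ?thesis
    unfolding mm_sizes_def card_filter_insert[OF assms(1,2)] using assms(3,4) by auto
qed

lemma mm_sizes_insert_2:
  assumes "finite \<A>" "C \<notin> \<A>" "card C = 2" "mm_sizes k \<A>" "k mod 3 \<noteq> 1"
  shows "mm_sizes (k + 2) (insert C \<A>)"
proof -
  have "k mod 3 = 0 \<and> (k + 2) mod 3 = 2 \<or> k mod 3 = 2 \<and> (k + 2) mod 3 = 1"
    using assms(5) by presburger
  then show ?thesis
    using assms(3,4) unfolding mm_sizes_def card_filter_insert[OF assms(1,2)] by auto
qed

lemma mm_sizes_insert_3:
  assumes "finite \<A>" "C \<notin> \<A>" "card C = 3" "mm_sizes k \<A>"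
  shows "mm_sizes (k + 3) (insert C \<A>)"
proof -
  have "(k + 3) mod 3 = k mod 3" by simp
  then show ?thesis
    using assms(3,4) unfolding mm_sizes_def card_filter_insert[OF assms(1,2)]
    by (auto split: if_splits)
qed

text \<open>The block of \<open>q\<close> contains exactly one chosen vertex, which is either
  \<open>q\<close> or an out-neighbour of \<open>q\<close>.\<close>

lemma choice_in_kernels:
  assumes "clique_union V D \<A>" "\<And>A. A \<in> \<A> \<Longrightarrow> f A \<in> A"
  shows "f ` \<A> \<in> kernels V D"
proof -
  have part: "partition_on V \<A>" and D: "\<And>A u. A \<in> \<A> \<Longrightarrow> u \<in> A \<Longrightarrow> D u \<inter> V = A - {u}"
    using assms(1) by (auto simp: clique_union_def)
  have U: "\<Union>\<A> = V" using partition_onD1[OF part] by simp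
  have uniq: "A = B" if "A \<in> \<A>" "B \<in> \<A>" "x \<in> A" "x \<in> B" for A B x
    using partition_onD2[OF part] that by (auto simp: disjoint_def)
  have sub: "f ` \<A> \<subseteq> V" using assms(2) U by blast
  have "q \<in> f ` \<A> \<longleftrightarrow> D q \<inter> f ` \<A> = {}" if "q \<in> V" for q
  proof -
    obtain A where A: "A \<in> \<A>" "q \<in> A" using U \<open>q \<in> V\<close> by blast
    have "x = f A" if "x \<in> A" "x \<in> f ` \<A>" for x
      using that uniq[of A _ x] assms(2) A by blast
    then have "D q \<inter> f ` \<A> = {f A} - {q}" and "q \<in> f ` \<A> \<longleftrightarrow> q = f A"
      using D[OF A] sub A assms(2) by blast+
    then show ?thesis by auto
  qed
  then show ?thesis using sub by (auto simp: kernels_def)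
qed

section \<open>The Moon-Moser bound for kernels\<close>

lemma sum_out_in:
  assumes "finite V" "\<And>u. u \<in> V \<Longrightarrow> u \<notin> D u"
  shows "(\<Sum>q\<in>V. card (D q \<inter> V)) = (\<Sum>q\<in>V. card (in_nbrs V D q))"
proof -
  have "(\<Sum>q\<in>V. card (D q \<inter> V)) = (\<Sum>q\<in>V. \<Sum>u\<in>V. of_bool (u \<in> D q))"
    using assms(1) by (intro sum.cong refl) (simp add: Int_commute)
  also have "\<dots> = (\<Sum>u\<in>V. \<Sum>q\<in>V. of_bool (u \<in> D q))"
    by (rule sum.swap)
  also have "\<dots> = (\<Sum>q\<in>V. card (in_nbrs V D q))"
  proof (intro sum.cong refl)
    fix x assume "x \<in> V"
    then have "in_nbrs V D x = {q \<in> V. x \<in> D q}" using assms(2) by (auto simp: in_nbrs_def)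
    then show "(\<Sum>q\<in>V. of_bool (x \<in> D q)) = card (in_nbrs V D x)"
      using assms(1) by (simp add: Collect_conj_eq)
  qed
  finally show ?thesis .
qed

text \<open>The equality clause omits \<open>card V = 1\<close> because a single vertex without a
  loop attains \<open>mm 1\<close> but cannot be split into blocks of size at least 2.\<close>

theorem kernels_le_mm:
  fixes V :: "'a set"
  assumes "finite V"
  shows "card (kernels V D) \<le> mm (card V) \<and>
    (card (kernels V D) = mm (card V) \<and> card V \<noteq> 1 \<longrightarrow>
      (\<exists>\<A>. clique_union V D \<A> \<and> mm_sizes (card V) \<A>))"
  using assms
proof (induction V rule: finite_psubset_induct)
  case (psubset V)
  note fin = psubset.hyps
  have bound: "card (kernels U D) \<le> mm (card U)" if "U \<subset> V" for U
    using psubset.IH[OF that] by blast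
  let ?n = "card V"
  let ?K = "card (kernels V D)"
  let ?o = "\<lambda>q. card (in_nbrs V D q)"
  let ?S = "\<lambda>q. {M \<in> kernels V D. q \<in> M}"
  have cardR: "card (V - {u} - in_nbrs V D u) = ?n - Suc (?o u)" if "u \<in> V" for u
    using card_without_in_nbrs[OF fin that, of D] by simp
  have oless: "?o q < ?n" if "q \<in> V" for q
    using fin that by (intro psubset_card_mono) (auto simp: in_nbrs_def)
  have SR: "card (?S q) \<le> mm (?n - Suc (?o q))" if "q \<in> V" for q
    using card_kernels_contain[OF fin, of D q] bound[of "V - {q} - in_nbrs V D q"] that cardR[OF that]
    by fastforce
  have avoid: "card {M \<in> kernels V D. q \<notin> M} \<le> card (kernels (V - {q}) D)" if "q \<in> V" for q
    using fin that by (intro card_mono kernels_avoid finite_kernels) auto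
  have Vq: "card (kernels (V - {q}) D) \<le> mm (?n - 1)" if "q \<in> V" for q
    using bound[of "V - {q}"] that by auto
  have split: "?K = card (?S q) + card {M \<in> kernels V D. q \<notin> M}" for q
  proof -
    have "kernels V D = ?S q \<union> {M \<in> kernels V D. q \<notin> M}" by auto
    then show ?thesis using finite_kernels[OF fin, of D]
      by (subst card_Un_disjoint[symmetric]) auto
  qed
  \<comment> \<open>For \<open>n = 1\<close> equality may hold, but then the second clause is void;
    otherwise \<open>mm (n - 1)\<close> is strictly below \<open>mm n\<close>.\<close>
  have small: ?case if "V \<noteq> {}" "?K \<le> mm (?n - 1)"
  proof -
    have "?n > 0" using that fin by (simp add: card_gt_0_iff)
    then show ?thesis using that mm_mono[of "?n - 1" ?n] mm_less[of "?n - 1" ?n] by force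
  qed
  \<comment> \<open>After loops, vertices without in- or out-neighbours and in-degrees above 2 are
    split off, either some out-degree is 1 or all are at least 2.\<close>
  consider "V = {}"
    | q where "q \<in> V" "q \<in> D q"
    | q where "q \<in> V" "q \<notin> D q" "in_nbrs V D q = {}"
    | q where "q \<in> V" "D q \<inter> V = {}"
    | q where "q \<in> V" "4 \<le> ?o q"
    | q where "q \<in> V" "?o q = 3" "q \<notin> D q"
    | q where "q \<in> V" "card (D q \<inter> V) = 1" "\<forall>u\<in>V. 1 \<le> ?o u" "\<forall>u\<in>V. u \<notin> D u"
    | "V \<noteq> {}" "\<forall>q\<in>V. 2 \<le> card (D q \<inter> V)" "\<forall>u\<in>V. ?o u \<le> 2" "\<forall>u\<in>V. u \<notin> D u"
  proof -
    have fi: "finite (in_nbrs V D u)" "finite (D u \<inter> V)" for u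
      using fin by (auto simp: in_nbrs_def)
    have "(\<exists>q\<in>V. q \<in> D q) \<or> (\<exists>q\<in>V. q \<notin> D q \<and> in_nbrs V D q = {}) \<or> (\<exists>q\<in>V. D q \<inter> V = {})
      \<or> (\<exists>q\<in>V. 4 \<le> ?o q) \<or> (\<exists>q\<in>V. ?o q = 3 \<and> q \<notin> D q)
      \<or> (\<exists>q\<in>V. card (D q \<inter> V) = 1 \<and> (\<forall>u\<in>V. 1 \<le> ?o u) \<and> (\<forall>u\<in>V. u \<notin> D u))
      \<or> (\<forall>q\<in>V. 2 \<le> card (D q \<inter> V)) \<and> (\<forall>u\<in>V. ?o u \<le> 2) \<and> (\<forall>u\<in>V. u \<notin> D u)" (is ?alt)
    proof (rule ccontr)
      assume neg: "\<not> ?alt"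
      then have l: "\<forall>u\<in>V. u \<notin> D u" by blast
      have o1: "\<forall>u\<in>V. 1 \<le> ?o u" using neg l fi by (simp add: Suc_le_eq card_gt_0_iff)
      have "?o u \<noteq> 3 \<and> \<not> 4 \<le> ?o u" if "u \<in> V" for u using neg l that by blast
      then have o2: "\<forall>u\<in>V. ?o u \<le> 2" by force
      have "card (D u \<inter> V) \<noteq> 1 \<and> card (D u \<inter> V) \<noteq> 0" if "u \<in> V" for u
        using neg l o1 that fi(2)[of u] by auto
      then have "\<forall>u\<in>V. 2 \<le> card (D u \<inter> V)" by force
      then show False using neg l o2 by blast
    qed
    then show ?thesis using that by blast
  qed
  then show ?case
  proof cases
    case 1
    then have "kernels V D = {{}}" by (auto simp: kernels_def)
    moreover have "clique_union V D {}" "mm_sizes (card V) {}"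
      using 1 by (auto simp: clique_union_def mm_sizes_def partition_on_def)
    ultimately show ?thesis using 1 by auto
  next
    \<comment> \<open>A vertex with a loop lies in no kernel.\<close>
    case (2 q)
    then have "?S q = {}" by (auto simp: kernels_def)
    then have "card (?S q) = 0" by (simp only: card.empty)
    then have "?K \<le> mm (?n - 1)" using split[of q] avoid[of q] Vq[of q] 2 by linarith
    then show ?thesis using small 2 by blast
  next
    \<comment> \<open>No other vertex depends on \<open>q\<close>, and the rest of a kernel
      determines whether it contains \<open>q\<close>.\<close>
    case (3 q)
    have "inj_on (\<lambda>M. M - {q}) (kernels V D)"
    proof (rule inj_onI)
      fix M N assume MN: "M \<in> kernels V D" "N \<in> kernels V D" "M - {q} = N - {q}"
      then have "q \<in> M \<longleftrightarrow> q \<in> N" using 3 by (simp add: kernels_def) blast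
      then show "M = N" using MN(3) by blast
    qed
    moreover have "(\<lambda>M. M - {q}) ` kernels V D \<subseteq> kernels (V - {q}) D"
      using 3 by (force simp: kernels_def in_nbrs_def)
    ultimately have "?K \<le> card (kernels (V - {q}) D)"
      using fin by (intro card_inj_on_le[of "\<lambda>M. M - {q}"] finite_kernels) auto
    then show ?thesis using small Vq[of q] 3 by fastforce
  next
    \<comment> \<open>A vertex without out-neighbours in \<open>V\<close> lies in every
      kernel.\<close>
    case (4 q)
    then have "?S q = kernels V D" using kernels_meet[of _ V D q] by auto
    then have "?K \<le> mm (?n - Suc (?o q))" using SR[of q] 4 by simp
    also have "\<dots> \<le> mm (?n - 1)" by (intro mm_mono) auto
    finally show ?thesis using small 4 by blast
  next
    case (5 q)
    have "5 \<le> ?n" using oless[OF 5(1)] 5(2) by linarith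
    then obtain k where k: "?n = k + 5" by (metis add.commute le_Suc_ex)
    then have n1: "?n - 1 = k + 4" by simp
    have "card (?S q) \<le> mm k"
      using SR[OF 5(1)] mm_mono[of "?n - Suc (?o q)" k] 5 k by linarith
    moreover have "card {M \<in> kernels V D. q \<notin> M} \<le> mm (k + 4)"
      using avoid[OF 5(1)] Vq[OF 5(1)] unfolding n1 by linarith
    ultimately have "?K < mm ?n" using split[of q] mm_one_five[of k] k by simp
    then show ?thesis by simp
  next
    case (6 q)
    have "4 \<le> ?n" using oless[OF 6(1)] 6(2) by linarith
    then obtain k where k: "?n = k + 4" by (metis add.commute le_Suc_ex)
    then have n1: "?n - 1 = k + 3" by simp
    have S: "card (?S q) \<le> mm k" using SR[OF 6(1)] 6 k by simp
    have N: "card {M \<in> kernels V D. q \<notin> M} \<le> mm (k + 3)"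
      using avoid[OF 6(1)] Vq[OF 6(1)] unfolding n1 by linarith
    have le: "?K \<le> mm ?n" using split[of q] mm_one_four[of k] k S N by simp
    moreover have "\<exists>\<A>. clique_union V D \<A> \<and> mm_sizes ?n \<A>" if eq: "?K = mm ?n"
    proof -
      have S': "card (?S q) = mm k" and N': "card {M \<in> kernels V D. q \<notin> M} = mm (k + 3)"
        and k3: "k mod 3 = 0"
        using split[of q] mm_one_four[of k] mm_one_four_eq[of k] k S N eq by auto
      have cq: "card (V - {q}) = k + 3" using k 6 fin by simp
      \<comment> \<open>Equality in the second branch means that every kernel of
        \<open>V - {q}\<close> is already a kernel of \<open>V\<close>, hence meets
        \<open>D q\<close>.\<close>
      have avoid_eq: "{M \<in> kernels V D. q \<notin> M} = kernels (V - {q}) D"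
        using N' Vq[OF 6(1), unfolded n1] fin 6(1)
        by (intro card_seteq kernels_avoid finite_kernels) auto
      have "card (kernels (V - {q}) D) = mm (card (V - {q}))"
        using N' avoid_eq cq by simp
      then obtain \<A> where \<A>: "clique_union (V - {q}) D \<A>" "mm_sizes (k + 3) \<A>"
        using psubset.IH[of "V - {q}"] 6 cq by auto
      have fA: "finite \<A>" using clique_union_finite \<A>(1) fin by blast
      have part: "partition_on (V - {q}) \<A>" using \<A>(1) by (simp add: clique_union_def)
      have U: "\<Union>\<A> = V - {q}" using partition_onD1[OF part] by simp
      \<comment> \<open>As \<open>k + 3\<close> is divisible by 3, \<open>mm_sizes\<close> admits
        only triangles.\<close>
      have A3: "card A = 3" if "A \<in> \<A>" for A
      proof -
        have "card {A \<in> \<A>. card A = 2} = 0" "card {A \<in> \<A>. card A = 4} = 0" "2 \<le> card A" "card A \<le> 4"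
          using \<A>(2) k3 that by (auto simp: mm_sizes_def)
        then have "card A \<noteq> 2" "card A \<noteq> 4" "2 \<le> card A" "card A \<le> 4" using fA that by auto
        then show ?thesis by linarith
      qed
      have DI: "D q \<inter> V \<subseteq> in_nbrs V D q"
      proof
        fix w assume w: "w \<in> D q \<inter> V"
        show "w \<in> in_nbrs V D q"
        proof (rule ccontr)
          assume "w \<notin> in_nbrs V D q"
          then obtain M where M: "M \<in> kernels V D" "q \<in> M" "w \<in> M"
            using tight_vertex[OF fin bound 6(1), of w] w 6 S' cardR[OF 6(1)] k by auto
          then show False using kernels_independent[OF M(1,2)] M(3) w by blast
        qed
      qed
      \<comment> \<open>Otherwise a vertex outside \<open>D q\<close> could be chosen from every
        block, giving a kernel of \<open>V - {q}\<close> that misses \<open>D q\<close>.\<close>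
      have "\<exists>T\<in>\<A>. T \<subseteq> D q"
      proof (rule ccontr)
        assume "\<not> ?thesis"
        then have "\<forall>A\<in>\<A>. \<exists>x. x \<in> A \<and> x \<notin> D q" by blast
        then obtain f where f: "\<forall>A\<in>\<A>. f A \<in> A \<and> f A \<notin> D q" using bchoice by metis
        then have "f ` \<A> \<in> kernels (V - {q}) D"
          using choice_in_kernels[OF \<A>(1), of f] by simp
        then have "f ` \<A> \<in> {M \<in> kernels V D. q \<notin> M}" using avoid_eq by simp
        then show False using f 6(1) by (auto simp: kernels_def)
      qed
      then obtain T where T: "T \<in> \<A>" "T \<subseteq> D q" by blast
      have TV: "T \<subseteq> V - {q}" using U T by blast
      have fi: "finite (in_nbrs V D q)" using fin by (auto simp: in_nbrs_def)
      \<comment> \<open>\<open>T\<close> lies in \<open>D q \<inter> V\<close>, which lies in the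
        in-neighbourhood by \<open>DI\<close>, and both ends have 3 elements.\<close>
      have TI: "T = in_nbrs V D q"
        using A3[OF T(1)] 6(2) TV T DI fi by (intro card_seteq) auto
      then have DT: "D q \<inter> V = T" using DI TV T by blast
      define C where "C = insert q T"
      have C4: "card C = 4"
        using A3[OF T(1)] TV finite_subset[OF TV] fin unfolding C_def
        by (subst card_insert_disjoint) auto
      have disj: "A \<inter> T = {}" if "A \<in> \<A> - {T}" for A
        using partition_onD2[OF part] that T by (auto simp: disjoint_def)
      have DA: "D u \<inter> (V - {q}) = A - {u}" if "A \<in> \<A>" "u \<in> A" for A u
        using \<A>(1) that by (auto simp: clique_union_def)
      have "clique_union (V - C) D (\<A> - {T})"
        unfolding clique_union_def
      proof (intro conjI ballI)
        have "\<Union>(\<A> - {T}) = V - C"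
        proof
          show "\<Union>(\<A> - {T}) \<subseteq> V - C" using U disj unfolding C_def by blast
          show "V - C \<subseteq> \<Union>(\<A> - {T})" using U unfolding C_def by blast
        qed
        then show "partition_on (V - C) (\<A> - {T})"
          using part unfolding partition_on_def disjoint_def by simp
        show "D u \<inter> (V - C) = A - {u}" if "A \<in> \<A> - {T}" "u \<in> A" for A u
          using DA[of A u] disj[OF that(1)] that unfolding C_def by blast
      qed
      moreover have "D u \<inter> V = C - {u}" if "u \<in> C" for u
      proof (cases "u = q")
        case True
        then show ?thesis using DT TV unfolding C_def by auto
      next
        case False
        then have "u \<in> T" using that C_def by blast
        moreover have "q \<in> D u" using TI calculation by (auto simp: in_nbrs_def)
        ultimately show ?thesis using DA[OF T(1), of u] 6(1) TV unfolding C_def by blast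
      qed
      moreover have "D x \<inter> C = {}" if "x \<in> V - C" for x
      proof -
        have "x \<in> V - {q}" using that C_def by blast
        then obtain A where A: "A \<in> \<A>" "x \<in> A" using U by blast
        then have "A \<noteq> T" using that C_def by blast
        moreover have "q \<notin> D x" using TI that C_def by (auto simp: in_nbrs_def)
        ultimately show ?thesis using DA[OF A] disj[of A] A TV unfolding C_def by blast
      qed
      ultimately have cu: "clique_union V D (insert C (\<A> - {T}))" "C \<notin> \<A> - {T}"
        using clique_union_insert[of V C D "\<A> - {T}"] TV 6(1) by (auto simp: C_def)
      have "mm_sizes ?n (insert C (\<A> - {T}))"
        unfolding k using fA cu(2) C4 A3 k3 by (intro mm_sizes_insert_4) auto
      then show ?thesis using cu by blast
    qed
    ultimately show ?thesis by blast
  next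
    case (7 q)
    define C where "C = insert q (D q \<inter> V)"
    have C2: "card C = 2" using 7 fin unfolding C_def by (subst card_insert_disjoint) auto
    have CV: "C \<subseteq> V" using 7 C_def by auto
    have "2 \<le> ?n" using card_mono[OF fin CV] C2 by simp
    then obtain k where k: "?n = k + 2" by (metis add.commute le_Suc_ex)
    have deg: "card C \<le> Suc (?o u)" if "u \<in> C" for u
      using C2 7(3) that CV by force
    note br = branch_clique[OF fin bound 7(1) C_def]
    have le: "?K \<le> 2 * mm k" using br(1) 7 deg C2 k by simp
    moreover have "\<exists>\<A>. clique_union V D \<A> \<and> mm_sizes ?n \<A>" if eq: "?K = mm ?n"
    proof -
      have K: "?K = 2 * mm k" and k3: "k mod 3 \<noteq> 1"
        using le mm_double[of k] eq k mm_double_eq[of k] by auto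
      then have "k \<noteq> 1" by auto
      then have b: "(\<forall>u\<in>C. D u \<inter> V = C - {u}) \<and> (\<forall>x\<in>V - C. D x \<inter> C = {}) \<and>
        card (kernels (V - C) D) = mm (card (V - C))"
        using br(2) K 7(4) deg C2 k by simp
      have c: "card (V - C) = k" using k C2 CV fin by (simp add: card_Diff_subset finite_subset)
      have "V - C \<subset> V" using CV C_def by blast
      then obtain \<A> where \<A>: "clique_union (V - C) D \<A>" "mm_sizes k \<A>"
        using psubset.IH[of "V - C"] b c k3 by auto
      have "C \<noteq> {}" using C_def by blast
      note cu = clique_union_insert[OF \<A>(1) CV this b[THEN conjunct1]
          b[THEN conjunct2, THEN conjunct1]]
      have "finite \<A>" using clique_union_finite[OF \<A>(1)] fin by simp
      then have "mm_sizes ?n (insert C \<A>)"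
        unfolding k using cu(2) C2 \<A>(2) k3 by (intro mm_sizes_insert_2) auto
      then show ?thesis using cu by blast
    qed
    ultimately show ?thesis using mm_double[of k] k by auto
  next
    case 8
    have noloop: "\<And>u. u \<in> V \<Longrightarrow> u \<notin> D u" using 8 by blast
    \<comment> \<open>Counting arcs by tail and by head gives an average in-degree of at least 2.
      Since none exceeds 2, all equal 2, and then some out-degree is exactly 2.\<close>
    have sums: "(\<Sum>q\<in>V. card (D q \<inter> V)) = (\<Sum>q\<in>V. ?o q)"
      using sum_out_in fin noloop by blast
    have lo: "card V * 2 \<le> (\<Sum>q\<in>V. card (D q \<inter> V))"
      using sum_bounded_below[of V 2 "\<lambda>q. card (D q \<inter> V)"] 8 by simp
    have o2: "?o u = 2" if "u \<in> V" for u
      using sum_eq_bound[of V ?o 2 u] 8 fin that lo sums by simp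
    have d2: "\<exists>q\<in>V. card (D q \<inter> V) = 2"
    proof (rule ccontr)
      assume "\<not> ?thesis"
      then have "\<And>q. q \<in> V \<Longrightarrow> 2 < card (D q \<inter> V)" using 8(2) by force
      then have "(\<Sum>q\<in>V. ?o q) < (\<Sum>q\<in>V. card (D q \<inter> V))"
        using 8 fin o2 by (intro sum_strict_mono) auto
      then show False using sums by simp
    qed
    then obtain q where q: "q \<in> V" "card (D q \<inter> V) = 2" by blast
    define C where "C = insert q (D q \<inter> V)"
    have C3: "card C = 3" using q fin noloop unfolding C_def by (subst card_insert_disjoint) auto
    have CV: "C \<subseteq> V" using q C_def by auto
    have "3 \<le> ?n" using card_mono[OF fin CV] C3 by simp
    then obtain k where k: "?n = k + 3" by (metis add.commute le_Suc_ex)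
    have deg: "card C \<le> Suc (?o u)" if "u \<in> C" for u
      using C3 o2 that CV by force
    note br = branch_clique[OF fin bound q(1) C_def]
    have le: "?K \<le> 3 * mm k" using br(1) noloop deg C3 k by simp
    moreover have "\<exists>\<A>. clique_union V D \<A> \<and> mm_sizes ?n \<A>" if eq: "?K = mm ?n"
    proof -
      have K: "?K = 3 * mm k" and k1: "k \<noteq> 1"
        using le mm_triple[of k] eq k mm_triple_eq[of k] by auto
      then have b: "(\<forall>u\<in>C. D u \<inter> V = C - {u}) \<and> (\<forall>x\<in>V - C. D x \<inter> C = {}) \<and>
        card (kernels (V - C) D) = mm (card (V - C))"
        using br(2) K noloop deg C3 k by simp
      have c: "card (V - C) = k" using k C3 CV fin by (simp add: card_Diff_subset finite_subset)
      have "V - C \<subset> V" using CV C_def by blast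
      then obtain \<A> where \<A>: "clique_union (V - C) D \<A>" "mm_sizes k \<A>"
        using psubset.IH[of "V - C"] b c k1 by auto
      have "C \<noteq> {}" using C_def by blast
      note cu = clique_union_insert[OF \<A>(1) CV this b[THEN conjunct1]
          b[THEN conjunct2, THEN conjunct1]]
      have "finite \<A>" using clique_union_finite[OF \<A>(1)] fin by simp
      then have "mm_sizes ?n (insert C \<A>)"
        unfolding k using cu(2) C3 \<A>(2) by (intro mm_sizes_insert_3) auto
      then show ?thesis using cu by blast
    qed
    ultimately show ?thesis using mm_triple[of k] k by auto
  qed
qed

section \<open>Counting the kernels of a clique union\<close>

lemma prod_card_sizes:
  assumes "finite \<A>" "\<forall>A\<in>\<A>. 2 \<le> card A \<and> card A \<le> 4"
  shows "(\<Prod>A\<in>\<A>. card A) = 2 ^ card {A\<in>\<A>. card A = 2} * 3 ^ card {A\<in>\<A>. card A = 3} *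
    4 ^ card {A\<in>\<A>. card A = 4}"
  using assms
proof (induction \<A>)
  case (insert C \<A>)
  then have "card C = 2 \<or> card C = 3 \<or> card C = 4" by auto
  then show ?case
    using insert by (auto simp: card_filter_insert simp del: insert_iff)
qed simp

lemma sum_card_sizes:
  assumes "finite \<A>" "\<forall>A\<in>\<A>. 2 \<le> card A \<and> card A \<le> 4"
  shows "(\<Sum>A\<in>\<A>. card A) = 2 * card {A\<in>\<A>. card A = 2} + 3 * card {A\<in>\<A>. card A = 3} +
    4 * card {A\<in>\<A>. card A = 4}"
  using assms
proof (induction \<A>)
  case (insert C \<A>)
  then have "card C = 2 \<or> card C = 3 \<or> card C = 4" by auto
  then show ?case
    using insert by (auto simp: card_filter_insert simp del: insert_iff)
qed simp

text \<open>The kernels are the transversals of the cliques: a kernel meets each clique by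
  \<open>kernels_meet\<close>, and only once by independence. Extensional choice functions make the
  correspondence injective.\<close>

lemma card_kernels_clique_union:
  assumes fin: "finite V" and cu: "clique_union V D \<A>"
  shows "card (kernels V D) = (\<Prod>A\<in>\<A>. card A)"
proof -
  have part: "partition_on V \<A>" and D: "\<And>A u. A \<in> \<A> \<Longrightarrow> u \<in> A \<Longrightarrow> D u \<inter> V = A - {u}"
    using cu by (auto simp: clique_union_def)
  have U: "\<Union>\<A> = V" using partition_onD1[OF part] by simp
  have uniq: "A = B" if "A \<in> \<A>" "B \<in> \<A>" "x \<in> A" "x \<in> B" for A B x
    using partition_onD2[OF part] that by (auto simp: disjoint_def)
  have "bij_betw (\<lambda>f. f ` \<A>) (Pi\<^sub>E \<A> (\<lambda>A. A)) (kernels V D)"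
    unfolding bij_betw_def
  proof (intro conjI inj_onI equalityI subsetI)
    fix f g assume fg: "f \<in> Pi\<^sub>E \<A> (\<lambda>A. A)" "g \<in> Pi\<^sub>E \<A> (\<lambda>A. A)" "f ` \<A> = g ` \<A>"
    have fA: "f A \<in> A" "g A \<in> A" if "A \<in> \<A>" for A
      using fg(1,2) that by (auto simp: PiE_mem)
    have "f A = g A" if "A \<in> \<A>" for A
    proof -
      obtain B where B: "B \<in> \<A>" "f A = g B" using fg(3) \<open>A \<in> \<A>\<close> by blast
      then have "A = B" using uniq[OF \<open>A \<in> \<A>\<close> B(1), of "f A"] fA[OF \<open>A \<in> \<A>\<close>] fA[OF B(1)] by simp
      then show ?thesis using B(2) by simp
    qed
    then show "f = g" using fg(1,2) by (intro PiE_ext) auto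
  next
    fix M assume "M \<in> (\<lambda>f. f ` \<A>) ` Pi\<^sub>E \<A> (\<lambda>A. A)"
    then obtain f where "f \<in> Pi\<^sub>E \<A> (\<lambda>A. A)" "M = f ` \<A>" by blast
    then show "M \<in> kernels V D" using choice_in_kernels[OF cu, of f] PiE_mem[of f \<A> "\<lambda>A. A"] by metis
  next
    fix M assume M: "M \<in> kernels V D"
    have "\<exists>x. x \<in> A \<and> x \<in> M" if A: "A \<in> \<A>" for A
    proof -
      obtain q where q: "q \<in> A" using partition_onD3[OF part] A by (metis ex_in_conv)
      then have "q \<in> V" using U A by blast
      then show ?thesis using kernels_meet[OF M, of q] D[OF A q] q by auto
    qed
    then obtain f where f: "\<forall>A\<in>\<A>. f A \<in> A \<and> f A \<in> M" using bchoice[of \<A> "\<lambda>A x. x \<in> A \<and> x \<in> M"] by blast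
    have only: "x = f A" if x: "A \<in> \<A>" "x \<in> A" "x \<in> M" for A x
    proof (rule ccontr)
      assume "x \<noteq> f A"
      then have "x \<in> A - {f A}" using x by blast
      then have "x \<in> D (f A)" using D[OF x(1), of "f A"] f x(1) by blast
      then show False using kernels_independent[OF M, of "f A" x] f x by blast
    qed
    have "M = f ` \<A>"
    proof
      show "f ` \<A> \<subseteq> M" using f by blast
      show "M \<subseteq> f ` \<A>"
      proof
        fix x assume x: "x \<in> M"
        then obtain A where "A \<in> \<A>" "x \<in> A" using M U by (auto simp: kernels_def)
        then show "x \<in> f ` \<A>" using only x by blast
      qed
    qed
    then have "M = restrict f \<A> ` \<A>" by simp
    moreover have "restrict f \<A> \<in> Pi\<^sub>E \<A> (\<lambda>A. A)" using f by (simp add: PiE_iff)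
    ultimately show "M \<in> (\<lambda>f. f ` \<A>) ` Pi\<^sub>E \<A> (\<lambda>A. A)" by blast
  qed
  then have "card (kernels V D) = card (Pi\<^sub>E \<A> (\<lambda>A. A))" by (simp add: bij_betw_same_card)
  then show ?thesis using clique_union_finite[OF cu fin] by (simp add: card_PiE)
qed

section \<open>Stable models as kernels\<close>

lemma stable_model_iff:
  "stable_model P M \<longleftrightarrow>
     (\<forall>c\<in>P. neg c \<inter> M = {} \<and> pos c \<subseteq> M \<longrightarrow> head c \<in> M) \<and>
     (\<forall>N. (\<forall>c\<in>P. neg c \<inter> M = {} \<and> pos c \<subseteq> N \<longrightarrow> head c \<in> N) \<longrightarrow> M \<subseteq> N)"
proof -
  have eq: "is_model N (reduct P M) \<longleftrightarrow> (\<forall>c\<in>P. neg c \<inter> M = {} \<and> pos c \<subseteq> N \<longrightarrow> head c \<in> N)" for N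
  proof -
    have "is_model N (reduct P M) \<longleftrightarrow>
      (\<forall>c\<in>P. neg c \<inter> M = {} \<longrightarrow> satisfies N (Clause (head c) (pos c) {}))"
      by (auto simp: is_model_def reduct_def)
    then show ?thesis by (simp add: satisfies_def imp_conjL)
  qed
  show ?thesis unfolding stable_model_def is_least_model_def eq by (rule refl)
qed

lemma stable_model_closed:
  "stable_model P M \<Longrightarrow> c \<in> P \<Longrightarrow> neg c \<inter> M = {} \<Longrightarrow> pos c \<subseteq> M \<Longrightarrow> head c \<in> M"
  unfolding stable_model_iff by (elim conjE) (drule (1) bspec, simp)

lemma stable_model_least:
  assumes "stable_model P M" "\<And>c. c \<in> P \<Longrightarrow> neg c \<inter> M = {} \<Longrightarrow> pos c \<subseteq> N \<Longrightarrow> head c \<in> N"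
  shows "M \<subseteq> N"
proof -
  have "(\<forall>c\<in>P. neg c \<inter> M = {} \<and> pos c \<subseteq> N \<longrightarrow> head c \<in> N) \<longrightarrow> M \<subseteq> N"
    using assms(1) unfolding stable_model_iff by (elim conjE) (rule spec)
  then show ?thesis using assms(2) by simp
qed

text \<open>The heads of the clauses whose bodies hold in \<open>M\<close> form a model of the
  reduct, so they include the least one.\<close>

lemma stable_model_supported:
  assumes M: "stable_model P M" and "q \<in> M"
  shows "\<exists>c\<in>P. head c = q \<and> pos c \<subseteq> M \<and> neg c \<inter> M = {}"
proof -
  let ?N = "head ` {c \<in> P. pos c \<subseteq> M \<and> neg c \<inter> M = {}}"
  have "?N \<subseteq> M" using stable_model_closed[OF M] by blast
  have "M \<subseteq> ?N"
  proof (rule stable_model_least[OF M])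
    fix c assume c: "c \<in> P" "neg c \<inter> M = {}" "pos c \<subseteq> ?N"
    have "pos c \<subseteq> M" using c(3) \<open>?N \<subseteq> M\<close> by (rule subset_trans)
    then show "head c \<in> ?N" using c(1,2) by simp
  qed
  then show ?thesis using \<open>q \<in> M\<close> by blast
qed

text \<open>A larger set has a smaller reduct, so \<open>M\<close> is a model of the reduct by
  \<open>N\<close>, and leastness of \<open>N\<close> applies.\<close>

lemma stable_model_antichain:
  assumes "stable_model P M" "stable_model P N" "M \<subseteq> N"
  shows "M = N"
proof -
  have "N \<subseteq> M"
    using assms(3) by (intro stable_model_least[OF assms(2)] stable_model_closed[OF assms(1)]) auto
  then show ?thesis using assms(3) by blast
qed

lemma finite_stable_models: "finite P \<Longrightarrow> finite {M. stable_model P M}"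
  by (rule finite_subset[of _ "Pow (heads P)"]; use stable_model_subset_heads in \<open>force simp: heads_def\<close>)

text \<open>The least model after deletion of all negative literals. It contains every stable model
  and rules out atoms supported only by positive loops.\<close>

inductive_set derivable :: "'a program \<Rightarrow> 'a set" for P where
  "c \<in> P \<Longrightarrow> (\<And>b. b \<in> pos c \<Longrightarrow> b \<in> derivable P) \<Longrightarrow> head c \<in> derivable P"

text \<open>When every atom has only one clause, the positive body atoms of a clause can be unfolded, and
  \<open>blocks P q x\<close> states that \<open>not x\<close> occurs in the clause for \<open>q\<close> after this unfolding.\<close>

inductive blocks :: "'a program \<Rightarrow> 'a \<Rightarrow> 'a \<Rightarrow> bool" for P where
  direct: "c \<in> P \<Longrightarrow> x \<in> neg c \<Longrightarrow> blocks P (head c) x"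
| via: "c \<in> P \<Longrightarrow> b \<in> pos c \<Longrightarrow> blocks P b x \<Longrightarrow> blocks P (head c) x"

lemma derivable_subset_heads: "derivable P \<subseteq> heads P"
proof
  fix q assume "q \<in> derivable P"
  then show "q \<in> heads P" by cases (auto simp: heads_def)
qed

text \<open>The only clause of a true atom must fire, as must those of its positive body atoms in
  turn, so no blocker is true. The converse is by induction on the derivation of the atom, whose
  positive body atoms have no further blockers.\<close>

lemma stable_model_kernel:
  assumes inj: "inj_on head P" and M: "stable_model P M"
  shows "M \<in> kernels (derivable P) (\<lambda>q. Collect (blocks P q))"
proof -
  have sub: "M \<subseteq> derivable P"
    by (rule stable_model_least[OF M]) (auto intro: derivable.intros)
  have fired: "pos c \<subseteq> M \<and> neg c \<inter> M = {}" if c: "c \<in> P" "head c \<in> M" for c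
  proof -
    obtain c' where c': "c' \<in> P" "head c' = head c" "pos c' \<subseteq> M" "neg c' \<inter> M = {}"
      using stable_model_supported[OF M c(2)] by blast
    then have "c' = c" using inj_onD[OF inj c'(2,1) c(1)] by simp
    then show ?thesis using c' by simp
  qed
  have out: "x \<notin> M" if "blocks P q x" "q \<in> M" for q x
    using that by (induction) (use fired in blast)+
  have "q \<in> M" if "q \<in> derivable P" "Collect (blocks P q) \<inter> M = {}" for q
    using that
  proof (induction)
    case (1 c)
    have "pos c \<subseteq> M"
    proof
      fix b assume b: "b \<in> pos c"
      then have "Collect (blocks P b) \<subseteq> Collect (blocks P (head c))"
        using blocks.via[OF 1(1)] by blast
      then show "b \<in> M" using 1 b by blast
    qed
    moreover have "neg c \<subseteq> Collect (blocks P (head c))" using blocks.direct[OF 1(1)] by blast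
    then have "neg c \<inter> M = {}" using "1.prems" by blast
    ultimately show ?case using stable_model_closed[OF M 1(1)] by blast
  qed
  then show ?thesis using sub out by (auto simp: kernels_def)
qed

lemma card_derivable_le:
  assumes "finite P"
  shows "finite (derivable P)" "card (derivable P) \<le> card P"
proof -
  have "finite (heads P)" "card (heads P) \<le> card P"
    using assms by (auto simp: heads_def card_image_le)
  then show "finite (derivable P)" "card (derivable P) \<le> card P"
    using derivable_subset_heads[of P] by (auto intro: finite_subset le_trans[OF card_mono])
qed

lemma num_stable_le_kernels:
  assumes "finite P" "inj_on head P"
  shows "num_stable P \<le> card (kernels (derivable P) (\<lambda>q. Collect (blocks P q)))"
  unfolding num_stable_def using stable_model_kernel[OF assms(2)]
  by (intro card_mono finite_kernels card_derivable_le assms(1)) blast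

section \<open>Deciding the truth value of an atom\<close>

definition assume_true :: "'a \<Rightarrow> 'a program \<Rightarrow> 'a program" where
  "assume_true q P = (\<lambda>c. Clause (head c) (pos c - {q}) (neg c)) ` {c \<in> P. head c \<noteq> q \<and> q \<notin> neg c}"

text \<open>Negated occurrences of \<open>q\<close> may stay: no remaining clause has head
  \<open>q\<close>, so \<open>q\<close> is false in every stable model of the result.\<close>

definition assume_false :: "'a \<Rightarrow> 'a program \<Rightarrow> 'a program" where
  "assume_false q P = {c \<in> P. head c \<noteq> q \<and> q \<notin> pos c}"

lemma stable_model_assume_true:
  assumes M: "stable_model P M" and "q \<in> M"
  shows "stable_model (assume_true q P) (M - {q})"
  unfolding stable_model_iff
proof (intro conjI allI impI ballI)
  fix c assume "c \<in> assume_true q P" "neg c \<inter> (M - {q}) = {} \<and> pos c \<subseteq> M - {q}"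
  then obtain d where d: "d \<in> P" "head d \<noteq> q" "q \<notin> neg d" "head c = head d"
    "neg d \<inter> (M - {q}) = {}" "pos d - {q} \<subseteq> M - {q}"
    unfolding assume_true_def by force
  then have "head d \<in> M"
    using \<open>q \<in> M\<close> by (intro stable_model_closed[OF M d(1)]) blast+
  then show "head c \<in> M - {q}" using d by simp
next
  fix N assume N: "\<forall>c\<in>assume_true q P. neg c \<inter> (M - {q}) = {} \<and> pos c \<subseteq> N \<longrightarrow> head c \<in> N"
  have "M \<subseteq> insert q N"
  proof (rule stable_model_least[OF M])
    fix c assume c: "c \<in> P" "neg c \<inter> M = {}" "pos c \<subseteq> insert q N"
    show "head c \<in> insert q N"
    proof (cases "head c = q")
      case False
      have "q \<notin> neg c" using c(2) \<open>q \<in> M\<close> by blast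
      then have "Clause (head c) (pos c - {q}) (neg c) \<in> assume_true q P"
        using c(1) False unfolding assume_true_def by blast
      then have "head c \<in> N" using N c(2,3) by force
      then show ?thesis by simp
    qed simp
  qed
  then show "M - {q} \<subseteq> N" by blast
qed

lemma stable_model_assume_false:
  assumes M: "stable_model P M" and "q \<notin> M"
  shows "stable_model (assume_false q P) M"
  unfolding stable_model_iff
proof (intro conjI allI impI ballI)
  fix c assume "c \<in> assume_false q P" "neg c \<inter> M = {} \<and> pos c \<subseteq> M"
  then show "head c \<in> M" using stable_model_closed[OF M] by (simp add: assume_false_def)
next
  fix N assume N: "\<forall>c\<in>assume_false q P. neg c \<inter> M = {} \<and> pos c \<subseteq> N \<longrightarrow> head c \<in> N"
  \<comment> \<open>Intersecting with \<open>M\<close> keeps \<open>q\<close> out of the heads and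
    positive bodies considered, so these clauses survive in \<open>assume_false q P\<close>.\<close>
  have "M \<subseteq> N \<inter> M"
  proof (rule stable_model_least[OF M])
    fix c assume c: "c \<in> P" "neg c \<inter> M = {}" "pos c \<subseteq> N \<inter> M"
    then have "head c \<in> M" using stable_model_closed[OF M] by blast
    moreover have "c \<in> assume_false q P"
      using c calculation \<open>q \<notin> M\<close> unfolding assume_false_def by blast
    ultimately show "head c \<in> N \<inter> M" using N c by blast
  qed
  then show "M \<subseteq> N" by blast
qed

text \<open>With distinct heads the kernel bound applies directly; the induction handles repeated
  heads. The strict part later shows that extremal programs have distinct heads.\<close>

lemma num_stable_le_mm:
  assumes "finite P"
  shows "num_stable P \<le> mm (card P) \<and> (\<not> inj_on head P \<longrightarrow> num_stable P < mm (card P))"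
  using assms
proof (induction "card P" arbitrary: P rule: less_induct)
  case less
  note fin = \<open>finite P\<close>
  show ?case
  proof (cases "inj_on head P")
    case True
    have "num_stable P \<le> card (kernels (derivable P) (\<lambda>q. Collect (blocks P q)))"
      using num_stable_le_kernels fin True by blast
    also have "\<dots> \<le> mm (card (derivable P))"
      using kernels_le_mm card_derivable_le(1)[OF fin] by blast
    also have "\<dots> \<le> mm (card P)"
      using mm_mono card_derivable_le(2)[OF fin] by blast
    finally show ?thesis using True by simp
  next
    case False
    then obtain c d where cd: "c \<in> P" "d \<in> P" "c \<noteq> d" "head c = head d"
      by (auto simp: inj_on_def)
    define q where "q = head c"
    define Q where "Q = {c \<in> P. head c \<noteq> q}"
    have finQ: "finite Q" using fin by (simp add: Q_def)
    have "Q \<subseteq> P - {c, d}" using cd by (auto simp: Q_def q_def)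
    then have "card Q \<le> card (P - {c, d})" using fin by (intro card_mono) auto
    moreover have "card (P - {c, d}) = card P - 2" "2 \<le> card P"
      using cd fin card_mono[OF fin, of "{c, d}"] by (auto simp: card_Diff_subset)
    ultimately have cardQ: "card Q + 2 \<le> card P" by linarith
    have T: "finite (assume_true q P)" "card (assume_true q P) \<le> card {c \<in> Q. q \<notin> neg c}"
    proof -
      have e: "{c \<in> P. head c \<noteq> q \<and> q \<notin> neg c} = {c \<in> Q. q \<notin> neg c}" by (auto simp: Q_def)
      show "finite (assume_true q P)" "card (assume_true q P) \<le> card {c \<in> Q. q \<notin> neg c}"
        unfolding assume_true_def e using finQ by (auto intro: card_image_le)
    qed
    have F: "finite (assume_false q P)" "card (assume_false q P) \<le> card {c \<in> Q. q \<notin> pos c}"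
    proof -
      have "assume_false q P = {c \<in> Q. q \<notin> pos c}" by (auto simp: Q_def assume_false_def)
      then show "finite (assume_false q P)" "card (assume_false q P) \<le> card {c \<in> Q. q \<notin> pos c}"
        using finQ by auto
    qed
    have Tn: "card {c \<in> Q. q \<notin> neg c} \<le> card Q" "card {c \<in> Q. q \<notin> pos c} \<le> card Q"
      using finQ by (auto intro: card_mono)
    have IH: "num_stable R \<le> mm m" if "finite R" "card R \<le> m" "m < card P" for R :: "'a program" and m
      using less(1)[of R] that mm_mono[OF that(2)] by fastforce
    let ?S1 = "{M. stable_model P M \<and> q \<in> M}"
    let ?S0 = "{M. stable_model P M \<and> q \<notin> M}"
    have S1: "card ?S1 \<le> num_stable (assume_true q P)"
      unfolding num_stable_def using stable_model_assume_true finite_stable_models[OF T(1)]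
      by (intro card_inj_on_le[OF inj_on_remove]) auto
    have S0: "card ?S0 \<le> num_stable (assume_false q P)"
      unfolding num_stable_def using stable_model_assume_false finite_stable_models[OF F(1)]
      by (intro card_mono) auto
    have "num_stable P = card (?S1 \<union> ?S0)"
      unfolding num_stable_def by (rule arg_cong[of _ _ card]) auto
    also have "\<dots> \<le> card ?S1 + card ?S0" by (rule card_Un_le)
    finally have split: "num_stable P \<le> num_stable (assume_true q P) + num_stable (assume_false q P)"
      using S1 S0 by linarith
    have "num_stable P < mm (card P)"
    proof (cases "\<exists>c\<in>Q. q \<in> pos c \<or> q \<in> neg c")
      case True
      then obtain e where e: "e \<in> Q" "q \<in> pos e \<or> q \<in> neg e" by blast
      then have "card Q \<noteq> 0" using finQ by auto
      then obtain m where m: "card Q = Suc m" by (cases "card Q") auto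
      have le: "mm (card Q) + mm m < mm (card P)"
        using mm_two_three[of m] mm_mono[of "m + 3" "card P"] cardQ m by simp
      \<comment> \<open>The clause \<open>e\<close> is deleted by \<open>assume_true\<close> if it
        contains \<open>q\<close> negatively and by \<open>assume_false\<close> if positively, so
        one branch loses a third clause.\<close>
      have lt: "card {c \<in> Q. q \<notin> neg c} < card Q \<or> card {c \<in> Q. q \<notin> pos c} < card Q"
        using e finQ by (auto intro!: psubset_card_mono)
      have full: "num_stable (assume_true q P) \<le> mm (card Q)" "num_stable (assume_false q P) \<le> mm (card Q)"
        using IH[OF T(1), of "card Q"] IH[OF F(1), of "card Q"] T F Tn cardQ by linarith+
      from lt show ?thesis
      proof
        assume "card {c \<in> Q. q \<notin> neg c} < card Q"
        then have "num_stable (assume_true q P) \<le> mm m"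
          using IH[OF T(1), of m] T cardQ m by linarith
        then show ?thesis using split full le by linarith
      next
        assume "card {c \<in> Q. q \<notin> pos c} < card Q"
        then have "num_stable (assume_false q P) \<le> mm m"
          using IH[OF F(1), of m] F cardQ m by linarith
        then show ?thesis using split full le by linarith
      qed
    next
      \<comment> \<open>Now \<open>q\<close> occurs in no clause of \<open>Q\<close>, so both
        branches reduce \<open>P\<close> to \<open>Q\<close>.\<close>
      case False
      have st: "stable_model (assume_true q P) (M - {q})" if M: "stable_model P M" for M
      proof (cases "q \<in> M")
        case True
        then show ?thesis by (rule stable_model_assume_true[OF M])
      next
        case qM: False
        have "assume_true q P = (\<lambda>c. c) ` Q"
          unfolding assume_true_def
        proof (rule image_cong)
          show "{c \<in> P. head c \<noteq> q \<and> q \<notin> neg c} = Q" using False by (auto simp: Q_def)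
          show "Clause (head c) (pos c - {q}) (neg c) = c" if "c \<in> Q" for c
            using False that by (cases c) auto
        qed
        also have "\<dots> = assume_false q P" using False by (auto simp: Q_def assume_false_def)
        finally show ?thesis using stable_model_assume_false[OF M qM] qM by simp
      qed
      \<comment> \<open>Two sets that agree outside \<open>q\<close> are comparable, so stable
        models with this property coincide.\<close>
      have "inj_on (\<lambda>M. M - {q}) {M. stable_model P M}"
      proof (rule inj_onI)
        fix M N assume MN: "M \<in> {M. stable_model P M}" "N \<in> {M. stable_model P M}" "M - {q} = N - {q}"
        then have "M \<subseteq> N \<or> N \<subseteq> M" by blast
        then show "M = N"
          using MN stable_model_antichain[of P M N] stable_model_antichain[of P N M] by auto
      qed
      then have "num_stable P \<le> num_stable (assume_true q P)"
        unfolding num_stable_def using st finite_stable_models[OF T(1)]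
        by (intro card_inj_on_le) auto
      also have "\<dots> \<le> mm (card Q)"
        using IH[OF T(1), of "card Q"] T Tn cardQ by linarith
      also have "\<dots> < mm (card P)" using cardQ by (intro mm_less) auto
      finally show ?thesis .
    qed
    then show ?thesis by simp
  qed
qed

section \<open>Extremal programs\<close>

lemma heads_overline: "heads (overline P) = heads P"
  by (auto simp: heads_def overline_def image_image)

text \<open>A redundant atom is in no stable model, so its negation always holds.\<close>

lemma num_stable_overline: "num_stable (overline P) = num_stable P"
proof -
  have same: "stable_model (overline P) M \<longleftrightarrow> stable_model P M" if "M \<subseteq> heads P" for M
  proof -
    have eq: "(neg c - {q. redundant P q}) \<inter> M = neg c \<inter> M" for c
      using that by (auto simp: redundant_def)
    show ?thesis
      unfolding stable_model_iff overline_def ball_simps clause.sel eq by (rule refl)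
  qed
  have "stable_model (overline P) M \<longleftrightarrow> stable_model P M" for M
  proof (cases "M \<subseteq> heads P")
    case True
    then show ?thesis by (rule same)
  next
    case False
    then show ?thesis
      using stable_model_subset_heads[of P M] stable_model_subset_heads[of "overline P" M]
      unfolding heads_overline by argo
  qed
  then show ?thesis by (simp add: num_stable_def)
qed

section \<open>Counting the stable models of unions of canonical programs\<close>

lemma stable_model_negative_program:
  "stable_model ((\<lambda>q. Clause q {} (D q)) ` V) M \<longleftrightarrow> M \<in> kernels V D"
proof
  assume "stable_model ((\<lambda>q. Clause q {} (D q)) ` V) M"
  then have closed: "\<forall>q\<in>V. D q \<inter> M = {} \<longrightarrow> q \<in> M"
    and least: "\<And>N. (\<forall>q\<in>V. D q \<inter> M = {} \<longrightarrow> q \<in> N) \<Longrightarrow> M \<subseteq> N"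
    by (auto simp: stable_model_iff)
  have "M \<subseteq> {q \<in> V. D q \<inter> M = {}}" by (rule least) blast
  then show "M \<in> kernels V D" using closed by (auto simp: kernels_def)
next
  assume "M \<in> kernels V D"
  then show "stable_model ((\<lambda>q. Clause q {} (D q)) ` V) M"
    by (auto simp: stable_model_iff kernels_def)
qed

text \<open>The union in \<open>D\<close> names the unique block containing \<open>q\<close>. This
  form makes \<open>stable_model_negative_program\<close> applicable.\<close>

lemma union_CP_eq:
  assumes part: "partition_on V \<A>"
  defines "D \<equiv> (\<lambda>q. \<Union>{A \<in> \<A>. q \<in> A} - {q})"
  shows "(\<Union>A\<in>\<A>. CP A) = (\<lambda>q. Clause q {} (D q)) ` V" "clique_union V D \<A>"
proof -
  have U: "\<Union>\<A> = V" using partition_onD1[OF part] by simp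
  have D: "D q = A - {q}" if "A \<in> \<A>" "q \<in> A" for A q
  proof -
    have "{A \<in> \<A>. q \<in> A} = {A}"
      using partition_onD2[OF part] that by (auto simp: disjoint_def)
    then show ?thesis by (simp add: D_def)
  qed
  have "(\<Union>A\<in>\<A>. CP A) = (\<Union>A\<in>\<A>. (\<lambda>q. Clause q {} (D q)) ` A)"
    unfolding CP_def using D by (intro SUP_cong refl image_cong) auto
  then show "(\<Union>A\<in>\<A>. CP A) = (\<lambda>q. Clause q {} (D q)) ` V"
    using U by auto
  have "D q \<inter> V = A - {q}" if "A \<in> \<A>" "q \<in> A" for A q
    using D[OF that] U that by blast
  then show "clique_union V D \<A>" using part by (simp add: clique_union_def)
qed

lemma num_stable_union_CP:
  assumes "partition_on V \<A>" "finite V"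
  shows "num_stable (\<Union>A\<in>\<A>. CP A) = (\<Prod>A\<in>\<A>. card A)"
  unfolding num_stable_def union_CP_eq(1)[OF assms(1)] stable_model_negative_program
  using card_kernels_clique_union[OF assms(2) union_CP_eq(2)[OF assms(1)]] by simp

lemma num_stable_program_234:
  assumes "program_234 P (i, j, l)"
  shows "num_stable P = 2 ^ i * 3 ^ j * 4 ^ l"
proof -
  obtain \<A> where \<A>: "finite \<A>" "partition_on (atoms P) \<A>" "\<forall>A\<in>\<A>. 2 \<le> card A \<and> card A \<le> 4"
    "P = (\<Union>A\<in>\<A>. CP A)"
    "i = card {A\<in>\<A>. card A = 2}" "j = card {A\<in>\<A>. card A = 3}" "l = card {A\<in>\<A>. card A = 4}"
    using assms by (auto simp: program_234_def)
  \<comment> \<open>\<open>card\<close> is 0 on infinite sets, so the lower bound 2 makes every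
    block finite.\<close>
  have "finite A" if "A \<in> \<A>" for A
  proof (rule card_ge_0_finite)
    show "0 < card A" using \<A>(3) that by fastforce
  qed
  then have "finite (atoms P)" using \<A>(1) partition_onD1[OF \<A>(2)] by simp
  then have "num_stable P = (\<Prod>A\<in>\<A>. card A)"
    using num_stable_union_CP[OF \<A>(2)] \<A>(4) by simp
  then show ?thesis using prod_card_sizes[OF \<A>(1,3)] \<A>(5-7) by simp
qed

text \<open>The count is made on \<open>overline P\<close> and so does not depend on the number of
  clauses of \<open>P\<close>.\<close>

lemma num_stable_EE:
  assumes "P \<in> EE n"
  shows "num_stable P = mm n"
proof -
  consider k where "n = 3 * k" "program_234 (overline P) (0, k, 0)"
    | k where "n = 3 * k + 2" "program_234 (overline P) (1, k, 0)"
    | k where "k \<ge> 1" "n = 3 * k + 1" "program_234 (overline P) (2, k - 1, 0)"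
    | k where "k \<ge> 1" "n = 3 * k + 1" "program_234 (overline P) (0, k - 1, 1)"
    using assms unfolding EE_def is_A_def is_B_def is_C_def is_C'_def by blast
  then show ?thesis
  proof cases
    case (1 k)
    then show ?thesis using num_stable_program_234[OF 1(2)] mm_values(1)[of k]
      by (simp add: num_stable_overline)
  next
    case (2 k)
    then show ?thesis using num_stable_program_234[OF 2(2)] mm_values(2)[of k]
      by (simp add: num_stable_overline)
  next
    case (3 k)
    then have "n = 3 * (k - 1) + 4" by simp
    then have "mm n = 4 * 3 ^ (k - 1)" by (simp only: mm_values(3))
    then show ?thesis using num_stable_program_234[OF 3(3)]
      by (simp add: num_stable_overline)
  next
    case (4 k)
    then have "n = 3 * (k - 1) + 4" by simp
    then have "mm n = 4 * 3 ^ (k - 1)" by (simp only: mm_values(3))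
    then show ?thesis using num_stable_program_234[OF 4(3)]
      by (simp add: num_stable_overline)
  qed
qed

lemma atoms_union_CP: "atoms (\<Union>A\<in>\<A>. CP A) = \<Union>\<A>"
  by (auto simp: atoms_def CP_def)

lemma EE_I:
  assumes "logic_program P" and n: "2 \<le> n" and sizes: "mm_sizes n \<A>" and fin: "finite V" "card V = n"
    and part: "partition_on V \<A>" and eq: "overline P = (\<Union>A\<in>\<A>. CP A)"
  shows "P \<in> EE n"
proof -
  have finA: "finite \<A>" using finite_elements[OF fin(1) part] .
  have at: "atoms (overline P) = V" unfolding eq atoms_union_CP using partition_onD1[OF part] by simp
  have sz: "\<forall>A\<in>\<A>. 2 \<le> card A \<and> card A \<le> 4" using sizes by (simp add: mm_sizes_def)
  define i j l where "i = card {A\<in>\<A>. card A = 2}" and "j = card {A\<in>\<A>. card A = 3}"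
    and "l = card {A\<in>\<A>. card A = 4}"
  have prog: "program_234 (overline P) (i, j, l)"
    unfolding program_234_def at using finA part sz eq unfolding i_def j_def l_def by blast
  have nsum: "n = 2 * i + 3 * j + 4 * l"
  proof -
    have "card V = (\<Sum>A\<in>\<A>. card A)"
      using partition_onD1[OF part] partition_onD2[OF part] fin(1)
      by (metis card_Union_disjoint finite_Union finite_UnionD rev_finite_subset Union_upper)
    then show ?thesis using sum_card_sizes[OF finA sz] fin(2) i_def j_def l_def by simp
  qed
  have "(i, l) \<in> (if n mod 3 = 0 then {(0, 0)} else if n mod 3 = 2 then {(1, 0)} else {(2, 0), (0, 1)})"
    using sizes unfolding mm_sizes_def i_def l_def by blast
  then consider "i = 0" "l = 0" | "i = 1" "l = 0" | "i = 2" "l = 0" | "i = 0" "l = 1"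
    by (auto split: if_splits)
  then show ?thesis
  proof cases
    case 1
    then have "n = 3 * j" "1 \<le> j" "is_A j (overline P)"
      using prog nsum n by (auto simp: is_A_def)
    then show ?thesis using assms(1) by (auto simp: EE_def)
  next
    case 2
    then have "n = 3 * j + 2" "is_B j (overline P)"
      using prog nsum n by (auto simp: is_B_def)
    then show ?thesis using assms(1) by (auto simp: EE_def)
  next
    \<comment> \<open>The index is \<open>Suc j\<close> because signatures of \<open>is_C\<close>
      and \<open>is_C'\<close> have \<open>k - 1\<close> triangles.\<close>
    case 3
    then have "n = 3 * Suc j + 1" "is_C (Suc j) (overline P)"
      using prog nsum n by (auto simp: is_C_def)
    then show ?thesis using assms(1) unfolding EE_def
      by (intro CollectI conjI disjI2[OF disjI2[OF exI[of _ "Suc j"]]]) auto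
  next
    case 4
    then have "n = 3 * Suc j + 1" "is_C' (Suc j) (overline P)"
      using prog nsum n by (auto simp: is_C'_def)
    then show ?thesis using assms(1) unfolding EE_def
      by (intro CollectI conjI disjI2[OF disjI2[OF exI[of _ "Suc j"]]]) auto
  qed
qed

text \<open>Equality forces \<open>n\<close> clauses with distinct derivable heads and a blocking
  digraph that is a clique union. It remains to recover the clauses from the digraph, that is, to
  show that positive bodies are empty.\<close>

lemma extremal_in_EE:
  assumes P: "P \<in> LP n" and n: "2 \<le> n" and eq: "num_stable P = mm n"
  shows "P \<in> EE n"
proof -
  let ?D = "\<lambda>q. Collect (blocks P q)"
  have lp: "logic_program P" and fin: "finite P" and "card P \<le> n"
    using P by (auto simp: LP_def logic_program_def)
  have cP: "card P = n"
  proof (rule ccontr)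
    assume "card P \<noteq> n"
    then have "mm (card P) < mm n" using \<open>card P \<le> n\<close> n by (intro mm_less) auto
    then show False using num_stable_le_mm[OF fin] eq by simp
  qed
  have inj: "inj_on head P" using num_stable_le_mm[OF fin] eq cP by fastforce
  define V where "V = derivable P"
  have finV: "finite V" using card_derivable_le[OF fin] by (simp add: V_def)
  have bound: "card (kernels V ?D) \<le> mm (card V)" using kernels_le_mm[OF finV] by blast
  have ge: "mm n \<le> card (kernels V ?D)"
    using num_stable_le_kernels[OF fin inj] eq by (simp add: V_def)
  have cV: "card V = n"
  proof (rule ccontr)
    assume "card V \<noteq> n"
    then have "card V < n" using card_derivable_le(2)[OF fin] cP by (simp add: V_def)
    then have "mm (card V) < mm n" using n by (intro mm_less) auto
    then show False using bound ge by simp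
  qed
  have VH: "V = heads P"
    using derivable_subset_heads[of P] fin cV cP card_image[OF inj]
    unfolding V_def heads_def by (intro card_seteq) auto
  have "card (kernels V ?D) = mm (card V)" using ge bound cV by simp
  then obtain \<A> where cu: "clique_union V ?D \<A>" and sizes: "mm_sizes n \<A>"
    using kernels_le_mm[OF finV, of ?D] cV n by auto
  have part: "partition_on V \<A>" and D: "\<And>A q. A \<in> \<A> \<Longrightarrow> q \<in> A \<Longrightarrow> ?D q \<inter> V = A - {q}"
    using cu by (auto simp: clique_union_def)
  have U: "\<Union>\<A> = V" using partition_onD1[OF part] by simp
  have uniq: "A = B" if "A \<in> \<A>" "B \<in> \<A>" "x \<in> A" "x \<in> B" for A B x
    using partition_onD2[OF part] that by (auto simp: disjoint_def)
  have posV: "pos c \<subseteq> V" if c: "c \<in> P" for c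
  proof -
    have "head c \<in> derivable P" using c VH by (simp add: V_def heads_def)
    then obtain c' where c': "head c = head c'" "c' \<in> P" "\<And>b. b \<in> pos c' \<Longrightarrow> b \<in> derivable P"
      by (cases) blast
    then have "c' = c" using inj_onD[OF inj c'(1)] c by simp
    then show ?thesis using c'(3) by (auto simp: V_def)
  qed
  \<comment> \<open>An atom in its own positive body could not be derived by its only
    clause.\<close>
  have irrefl: "head c \<notin> pos c" if c: "c \<in> P" for c
  proof
    assume loop: "head c \<in> pos c"
    have "x \<noteq> head c" if "x \<in> derivable P" for x
      using that
    proof induction
      case (1 c')
      show ?case
      proof
        assume "head c' = head c"
        then have "c' = c" using inj_onD[OF inj _ 1(1) c] by simp
        then show False using 1(3) loop by blast
      qed
    qed
    moreover have "head c \<in> derivable P" using c VH by (simp add: V_def heads_def)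
    ultimately show False by blast
  qed
  \<comment> \<open>A positive body atom \<open>b\<close> passes its blockers on to
    \<open>q\<close>. Its block has a further vertex, so \<open>b\<close> and \<open>q\<close> share
    a block; then \<open>BA\<close> forces \<open>q = b\<close>, against
    \<open>irrefl\<close>.\<close>
  have pos: "pos c = {}" if c: "c \<in> P" for c
  proof (rule ccontr)
    assume "pos c \<noteq> {}"
    then obtain b where b: "b \<in> pos c" by blast
    define q where "q = head c"
    have "q \<in> V" using c VH by (auto simp: q_def heads_def)
    then obtain A where A: "A \<in> \<A>" "q \<in> A" using U by blast
    have "b \<in> V" using posV[OF c] b by blast
    then obtain B where B: "B \<in> \<A>" "b \<in> B" using U by blast
    have sub: "?D b \<subseteq> ?D q" using blocks.via[OF c b] by (auto simp: q_def)
    then have BA: "B - {b} \<subseteq> A - {q}" using D[OF A] D[OF B] by blast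
    have "B \<noteq> {b}" using sizes B(1) by (auto simp: mm_sizes_def)
    then obtain x where "x \<in> B - {b}" using B(2) by blast
    then have "A = B" using BA uniq[OF A(1) B(1), of x] by blast
    then have "q = b" using BA A(2) by blast
    then show False using irrefl[OF c] b by (simp add: q_def)
  qed
  have neg: "?D (head c) = neg c" if c: "c \<in> P" for c
  proof
    show "neg c \<subseteq> ?D (head c)" using blocks.direct[OF c] by blast
    show "?D (head c) \<subseteq> neg c"
    proof
      fix x assume "x \<in> ?D (head c)"
      then have "blocks P (head c) x" by simp
      then show "x \<in> neg c"
      proof cases
        case (direct c')
        then have "c' = c" using inj_onD[OF inj _ direct(2) c] by simp
        then show ?thesis using direct by simp
      next
        case (via c' b)
        then show ?thesis using pos by blast
      qed
    qed
  qed
  have red: "neg c - {q. redundant P q} = neg c \<inter> V" if c: "c \<in> P" for c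
    unfolding VH using c by (auto simp: redundant_def atoms_def)
  have cl: "Clause (head c) (pos c) (neg c - {q. redundant P q}) = Clause (head c) {} (A - {head c})"
    if "c \<in> P" "A \<in> \<A>" "head c \<in> A" for c A
    using red[OF that(1)] pos[OF that(1)] neg[OF that(1)] D[OF that(2,3)] by simp
  have "overline P = (\<Union>A\<in>\<A>. CP A)"
  proof (intro equalityI subsetI)
    fix d assume "d \<in> overline P"
    then obtain c where c: "c \<in> P" "d = Clause (head c) (pos c) (neg c - {q. redundant P q})"
      by (auto simp: overline_def)
    then have "head c \<in> V" using VH by (simp add: heads_def)
    then obtain A where A: "A \<in> \<A>" "head c \<in> A" using U by blast
    then have "d \<in> CP A" using cl[OF c(1) A] c(2) by (simp add: CP_def)
    then show "d \<in> (\<Union>A\<in>\<A>. CP A)" using A by blast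
  next
    fix d assume "d \<in> (\<Union>A\<in>\<A>. CP A)"
    then obtain A q where A: "A \<in> \<A>" "q \<in> A" "d = Clause q {} (A - {q})" by (auto simp: CP_def)
    then have "q \<in> heads P" using U VH by blast
    then obtain c where c: "c \<in> P" "q = head c" by (auto simp: heads_def)
    then have "d = Clause (head c) (pos c) (neg c - {q. redundant P q})"
      using cl[OF c(1) A(1)] A by simp
    then show "d \<in> overline P" using c(1) unfolding overline_def by blast
  qed
  then show ?thesis using EE_I[OF lp n sizes finV cV part] by blast
qed

section \<open>Existence of programs attaining the bound\<close>

lemma exists_fresh_block:
  fixes \<A> :: "'a::infinite set set"
  assumes "finite (\<Union>\<A>)" "0 < m"
  shows "\<exists>C. finite C \<and> card C = m \<and> C \<inter> \<Union>\<A> = {} \<and> C \<notin> \<A>"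
proof -
  have "infinite (UNIV - \<Union>\<A>)" using assms(1) by (simp add: infinite_UNIV)
  then obtain C where C: "finite C" "card C = m" "C \<subseteq> UNIV - \<Union>\<A>"
    using infinite_arbitrarily_large by blast
  moreover have "C \<noteq> {}" using C(2) assms(2) by auto
  ultimately show ?thesis by blast
qed

lemma exists_blocks:
  "\<exists>\<A> :: 'a::infinite set set. finite \<A> \<and> finite (\<Union>\<A>) \<and> disjoint \<A> \<and>
     (\<forall>A\<in>\<A>. 2 \<le> card A \<and> card A \<le> 4) \<and> card {A\<in>\<A>. card A = 2} = i \<and>
     card {A\<in>\<A>. card A = 3} = j \<and> card {A\<in>\<A>. card A = 4} = 0"
  (is "\<exists>\<A>. ?good i j \<A>")
proof (induction i)
  case 0
  show ?case
  proof (induction j)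
    case 0
    have "?good 0 0 {}" by simp
    then show ?case by blast
  next
    case (Suc j)
    then obtain \<A> :: "'a set set" where \<A>: "?good 0 j \<A>" by blast
    then obtain C where C: "finite C" "card C = 3" "C \<inter> \<Union>\<A> = {}" "C \<notin> \<A>"
      using exists_fresh_block[of \<A> 3] by auto
    then have "?good 0 (Suc j) (insert C \<A>)"
      using \<A> by (auto simp: card_filter_insert disjoint_def simp del: insert_iff)
    then show ?case by blast
  qed
next
  case (Suc i)
  then obtain \<A> :: "'a set set" where \<A>: "?good i j \<A>" by blast
  then obtain C where C: "finite C" "card C = 2" "C \<inter> \<Union>\<A> = {}" "C \<notin> \<A>"
    using exists_fresh_block[of \<A> 2] by auto
  then have "?good (Suc i) j (insert C \<A>)"
    using \<A> by (auto simp: card_filter_insert disjoint_def simp del: insert_iff)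
  then show ?case by blast
qed

text \<open>Blocks of sizes 2 and 3 provide a witness in every residue class; for
  \<open>n mod 3 = 1\<close> it satisfies \<open>is_C\<close>.\<close>

lemma exists_program_234:
  "\<exists>P :: 'a::infinite program. logic_program P \<and> card P \<le> 2 * i + 3 * j \<and>
     overline P = P \<and> program_234 P (i, j, 0)"
proof -
  obtain \<A> :: "'a set set" where \<A>: "finite \<A>" "finite (\<Union>\<A>)" "disjoint \<A>"
     "\<forall>A\<in>\<A>. 2 \<le> card A \<and> card A \<le> 4" "card {A\<in>\<A>. card A = 2} = i"
     "card {A\<in>\<A>. card A = 3} = j" "card {A\<in>\<A>. card A = 4} = 0"
    using exists_blocks by blast
  define P where "P = (\<Union>A\<in>\<A>. CP A)"
  have "{} \<notin> \<A>" using \<A>(4) by force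
  then have part: "partition_on (\<Union>\<A>) \<A>" using \<A>(3) by (simp add: partition_on_def)
  have at: "atoms P = \<Union>\<A>" unfolding P_def by (rule atoms_union_CP)
  have "heads P = \<Union>\<A>" unfolding P_def heads_def CP_def image_UN image_image by simp
  then have nored: "{q. redundant P q} = {}" using at by (auto simp: redundant_def)
  have ov: "overline P = P" unfolding overline_def nored by simp
  have "finite A" if "A \<in> \<A>" for A using \<A>(2) that by (meson Union_upper finite_subset)
  then have lp: "logic_program P"
    using \<A>(1) by (auto simp: logic_program_def P_def CP_def)
  have "card P \<le> card (\<Union>\<A>)"
    unfolding P_def union_CP_eq(1)[OF part] using \<A>(2) by (rule card_image_le)
  also have "\<dots> \<le> (\<Sum>A\<in>\<A>. card A)" by (rule card_Union_le_sum_card)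
  also have "\<dots> = 2 * i + 3 * j" using sum_card_sizes[OF \<A>(1,4)] \<A>(5-7) by simp
  finally have "card P \<le> 2 * i + 3 * j" .
  moreover have "program_234 P (i, j, 0)"
    unfolding program_234_def at using \<A> part P_def by (intro exI[of _ \<A>]) auto
  ultimately show ?thesis using lp ov by blast
qed

lemma LP_EE_nonempty:
  assumes "2 \<le> n"
  shows "\<exists>P :: 'a::infinite program. P \<in> LP n \<inter> EE n"
proof -
  have "n = 3 * (n div 3) \<and> 1 \<le> n div 3 \<or> n = 3 * (n div 3) + 2 \<or> n = 3 * (n div 3) + 1 \<and> 1 \<le> n div 3"
    using assms by presburger
  then consider k where "1 \<le> k" "n = 3 * k" | k where "n = 3 * k + 2" | k where "1 \<le> k" "n = 3 * k + 1"
    by blast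
  then show ?thesis
  proof cases
    case (1 k)
    obtain P :: "'a program" where P: "logic_program P" "card P \<le> 2 * 0 + 3 * k"
      "overline P = P" "program_234 P (0, k, 0)" using exists_program_234 by blast
    then show ?thesis using 1 by (intro exI[of _ P]) (auto simp: LP_def EE_def is_A_def)
  next
    case (2 k)
    obtain P :: "'a program" where P: "logic_program P" "card P \<le> 2 * 1 + 3 * k"
      "overline P = P" "program_234 P (1, k, 0)" using exists_program_234 by blast
    then show ?thesis using 2 by (intro exI[of _ P]) (auto simp: LP_def EE_def is_B_def)
  next
    case (3 k)
    obtain P :: "'a program" where P: "logic_program P" "card P \<le> 2 * 2 + 3 * (k - 1)"
      "overline P = P" "program_234 P (2, k - 1, 0)" using exists_program_234 by blast
    then have "P \<in> LP n" "is_C k (overline P)" using 3 by (auto simp: LP_def is_C_def)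
    then show ?thesis using 3 P(1) by (intro exI[of _ P]) (auto simp: EE_def)
  qed
qed

text \<open>The extremal class is intersected with \<open>LP n\<close> because a member of
  \<open>EE n\<close> can have more than \<open>n\<close> clauses. The last conjunct records that it
  still has the maximal number of stable models.\<close>

theorem theorem3:
  fixes n :: nat
  assumes "n \<ge> 2"
  shows "real (max_stable TYPE('a::infinite) n) = s0 n \<and>
    (\<forall>P \<in> (extremal n :: 'a program set). real (num_stable P) = s0 n) \<and>
    (extremal n :: 'a program set) = LP n \<inter> EE n \<and>
    (\<forall>P \<in> (EE n :: 'a program set). num_stable P = max_stable TYPE('a) n)"
proof -
  have le: "num_stable P \<le> mm n" if "P \<in> LP n" for P :: "'a program"
  proof -
    have "finite P" "card P \<le> n" using that by (auto simp: LP_def logic_program_def)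
    then show ?thesis using num_stable_le_mm[of P] mm_mono[of "card P" n] by linarith
  qed
  obtain Q :: "'a program" where Q: "Q \<in> LP n" "Q \<in> EE n" using LP_EE_nonempty[OF assms] by blast
  have max: "max_stable TYPE('a) n = mm n"
    unfolding max_stable_def
  proof (rule Max_eqI[OF finite_num_stable_LP])
    show "mm n \<in> num_stable ` (LP n :: 'a program set)"
      using Q(1) num_stable_EE[OF Q(2)] by (metis imageI)
  qed (use le in auto)
  have ext: "(extremal n :: 'a program set) = LP n \<inter> EE n"
    using extremal_in_EE[OF _ assms] num_stable_EE by (auto simp: extremal_def max)
  show ?thesis
    using ext max s0_eq_mm[OF assms] num_stable_EE by (auto simp: extremal_def)
qed

end
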